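(* Let $\mathsf{M}$ be a sparse paving matroid of rank $k$ on $n$ elements with exactly $\lambda$ circuit-hyperplanes. Then $$Y_{\mathsf{M}}(t)=Y_{\mathsf{U}_{k,n}}(t)-\lambda\left((1+t)^k-\tfrac12\left((-1)^k+1\right)C_{k/2}\,t^{k/2}\right),$$ where $C_m=\frac{1}{m+1}\binom{2m}{m}$ is the $m$-th Catalan number (the term involving $C_{k/2}$ vanishes when $k$ is odd).
   Context: A matroid $\mathsf{M}$ is paving if every circuit has size at least $\mathrm{rk}(\mathsf{M})$; it is sparse paving if both $\mathsf{M}$ and its dual are paving. A hyperplane is a flat of rank $\mathrm{rk}(\mathsf{M})-1$; a circuit-hyperplane is a set that is both a circuit and a hyperplane. $\mathsf{U}_{k,n}$ is the uniform matroid of rank $k$ on $[n]$. For a matroid $\mathsf{M}$, $\mathcal{L}(\mathsf{M})$ is its lattice of flats, $\mathsf{M}|_F$, $\mathsf{M}/F$ restriction and contraction, $\mathrm{rk}(\mathsf{M}/F)=\mathrm{rk}(\mathsf{M})-\mathrm{rk}(F)$. For loopless $\mathsf{M}$, $\mu_{\mathsf{M}}=\mu(\emptyset,E)$ in $\mathcal{L}(\mathsf{M})$ ($=1$ in rank 0), $\chi_{\mathsf{M}}(t)=\sum_{F}\mu_{\mathsf{M}|_F}t^{\mathrm{rk}(\mathsf{M}/F)}$; the inverse Kazhdan–Lusztig polynomial $Q_{\mathsf{M}}(t)$ is the unique assignment with $Q_{\mathsf{M}}=1$ in rank 0, $\deg Q_{\mathsf{M}}<\mathrm{rk}(\mathsf{M})/2$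 in positive rank, and $(-t)^{\mathrm{rk}(\mathsf{M})}Q_{\mathsf{M}}(t^{-1})=\sum_{F\in\mathcal{L}(\mathsf{M})}(-1)^{\mathrm{rk}(F)}Q_{\mathsf{M}|_F}(t)t^{\mathrm{rk}(\mathsf{M}/F)}\chi_{\mathsf{M}/F}(t^{-1})$. The inverse $Z$-polynomial of loopless $\mathsf{M}$ is $Y_{\mathsf{M}}(t)=(-1)^{\mathrm{rk}(\mathsf{M})}\sum_{F\in\mathcal{L}(\mathsf{M})}(-1)^{\mathrm{rk}(F)}Q_{\mathsf{M}|_F}(t)t^{\mathrm{rk}(\mathsf{M}/F)}\mu_{\mathsf{M}/F}$; for $\mathsf{M}$ with loops, $Y_{\mathsf{M}}:=Y$ of $\mathsf{M}$ with its loops deleted.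
   Formalization: When k = 1 the matroid is assumed loopless: a rank-1 sparse paving matroid with a loop has λ = 1 and Y_M = 1 + t, while the right-hand side of the formula is 0, so the claim fails exactly there. *)

theory Defs
  imports "HOL-Computational_Algebra.Polynomial"
begin

section \<open>Finite matroids, given by their independent sets\<close>

record 'a indep_system =
  ground :: "'a set"
  indep :: "'a set set"

locale matroid =
  fixes M :: "'a indep_system"
  assumes finite_ground: "finite (ground M)"
    and indep_subset: "X \<in> indep M \<Longrightarrow> X \<subseteq> ground M"
    and indep_empty: "{} \<in> indep M"
    and indep_mono: "X \<in> indep M \<Longrightarrow> Y \<subseteq> X \<Longrightarrow> Y \<in> indep M"
    and indep_augment: "X \<in> indep M \<Longrightarrow> Y \<in> indep M \<Longrightarrow> card X < card Y \<Longrightarrow>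
      \<exists>y \<in> Y - X. insert y X \<in> indep M"

definition rank :: "'a indep_system \<Rightarrow> 'a set \<Rightarrow> nat" where
  "rank M X = Max (card ` {Y \<in> indep M. Y \<subseteq> X})"

definition rk :: "'a indep_system \<Rightarrow> nat" where
  "rk M = rank M (ground M)"

definition circuit :: "'a indep_system \<Rightarrow> 'a set \<Rightarrow> bool" where
  "circuit M C \<longleftrightarrow> C \<subseteq> ground M \<and> C \<notin> indep M \<and> (\<forall>D. D \<subset> C \<longrightarrow> D \<in> indep M)"

definition basis :: "'a indep_system \<Rightarrow> 'a set \<Rightarrow> bool" where
  "basis M B \<longleftrightarrow> B \<in> indep M \<and> (\<forall>X \<in> indep M. B \<subseteq> X \<longrightarrow> X = B)"

definition dual :: "'a indep_system \<Rightarrow> 'a indep_system" where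
  "dual M = \<lparr>ground = ground M,
    indep = {X. X \<subseteq> ground M \<and> (\<exists>B. basis M B \<and> X \<inter> B = {})}\<rparr>"

definition flat :: "'a indep_system \<Rightarrow> 'a set \<Rightarrow> bool" where
  "flat M F \<longleftrightarrow> F \<subseteq> ground M \<and> (\<forall>x \<in> ground M - F. rank M F < rank M (insert x F))"

definition flats :: "'a indep_system \<Rightarrow> 'a set set" where
  "flats M = {F. flat M F}"

text \<open>The rank condition is not written with truncated subtraction: a matroid of rank 0 has no
  hyperplanes.\<close>

definition hyperplane :: "'a indep_system \<Rightarrow> 'a set \<Rightarrow> bool" where
  "hyperplane M H \<longleftrightarrow> flat M H \<and> rank M H + 1 = rk M"

definition circuit_hyperplane :: "'a indep_system \<Rightarrow> 'a set \<Rightarrow> bool" where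
  "circuit_hyperplane M C \<longleftrightarrow> circuit M C \<and> hyperplane M C"

definition paving :: "'a indep_system \<Rightarrow> bool" where
  "paving M \<longleftrightarrow> (\<forall>C. circuit M C \<longrightarrow> rk M \<le> card C)"

definition sparse_paving :: "'a indep_system \<Rightarrow> bool" where
  "sparse_paving M \<longleftrightarrow> paving M \<and> paving (dual M)"

definition uniform_matroid :: "nat \<Rightarrow> nat \<Rightarrow> nat indep_system" where
  "uniform_matroid k n = \<lparr>ground = {1..n}, indep = {X. X \<subseteq> {1..n} \<and> card X \<le> k}\<rparr>"

definition restrict :: "'a indep_system \<Rightarrow> 'a set \<Rightarrow> 'a indep_system" where
  "restrict M F = \<lparr>ground = F, indep = {X \<in> indep M. X \<subseteq> F}\<rparr>"

text \<open>The independent sets of the contraction are those of its rank function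
  \<open>X \<mapsto> rank M (X \<union> F) - rank M F\<close>.\<close>

definition contract :: "'a indep_system \<Rightarrow> 'a set \<Rightarrow> 'a indep_system" where
  "contract M F = \<lparr>ground = ground M - F,
    indep = {X. X \<subseteq> ground M - F \<and> rank M (X \<union> F) = card X + rank M F}\<rparr>"

definition loops :: "'a indep_system \<Rightarrow> 'a set" where
  "loops M = {x \<in> ground M. {x} \<notin> indep M}"

definition loopless :: "'a indep_system \<Rightarrow> bool" where
  "loopless M \<longleftrightarrow> loops M = {}"


section \<open>Characteristic polynomial\<close>

text \<open>Moebius function of a family \<open>L\<close> of finite sets ordered by inclusion. It is meant for
  arguments \<open>A, B \<in> L\<close>; the test \<open>finite B\<close> only serves termination.\<close>

function moebius :: "'a set set \<Rightarrow> 'a set \<Rightarrow> 'a set \<Rightarrow> int" where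
  "moebius L A B =
    (if A = B then 1
     else if A \<subset> B \<and> finite B then - (\<Sum>C \<in> {C \<in> L. A \<subseteq> C \<and> C \<subset> B}. moebius L A C)
     else 0)"
  by auto
termination
  by (relation "measure (\<lambda>(L, A, B). card B)") (auto intro: psubset_card_mono)

declare moebius.simps [simp del]

definition mu :: "'a indep_system \<Rightarrow> int" where
  "mu M = moebius (flats M) {} (ground M)"

definition char_poly :: "'a indep_system \<Rightarrow> int poly" where
  "char_poly M = (\<Sum>F \<in> flats M. monom (mu (restrict M F)) (rk (contract M F)))"


section \<open>Inverse Kazhdan--Lusztig polynomial and inverse Z-polynomial\<close>

text \<open>\<open>reversal r p\<close> stands for \<open>t ^ r * p (1 / t)\<close>, a polynomial whenever \<open>degree p \<le> r\<close>.\<close>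

definition reversal :: "nat \<Rightarrow> 'a::comm_semiring_1 poly \<Rightarrow> 'a poly" where
  "reversal r p = (\<Sum>i\<le>r. monom (coeff p i) (r - i))"

lemma poly_reversal:
  fixes p :: "'a::field poly"
  assumes "degree p \<le> r" "t \<noteq> 0"
  shows "poly (reversal r p) t = t ^ r * poly p (1 / t)"
proof -
  have "poly p (1 / t) = (\<Sum>i\<le>r. coeff p i * (1 / t) ^ i)"
    unfolding poly_altdef using assms(1)
    by (intro sum.mono_neutral_left) (auto simp: coeff_eq_0)
  then have "t ^ r * poly p (1 / t) = (\<Sum>i\<le>r. t ^ r * (coeff p i * (1 / t) ^ i))"
    by (simp only: sum_distrib_left)
  also have "\<dots> = (\<Sum>i\<le>r. coeff p i * t ^ (r - i))"
    using assms(2) by (intro sum.cong) (auto simp: power_diff power_one_over)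
  finally show ?thesis
    by (simp add: reversal_def poly_sum poly_monom)
qed

text \<open>In the functional equation,
  \<open>reversal (rk (contract M F)) (char_poly (contract M F))\<close> is the factor
  \<open>t ^ rk (M / F) * \<chi> (M / F) (1 / t)\<close>, and the left-hand side is
  \<open>(- t) ^ rk M * Q M (1 / t)\<close>; both degree bounds required by \<open>reversal\<close> hold. The last clause
  only fixes the values outside the loopless matroids, so that the assignment is unique as a
  function on the whole type.\<close>

definition is_inverse_KL :: "('a indep_system \<Rightarrow> int poly) \<Rightarrow> bool" where
  "is_inverse_KL Q \<longleftrightarrow>
    (\<forall>M. matroid M \<and> loopless M \<longrightarrow>
      (rk M = 0 \<longrightarrow> Q M = 1) \<and>
      (0 < rk M \<longrightarrow> 2 * degree (Q M) < rk M) \<and>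
      (-1) ^ rk M * reversal (rk M) (Q M) =
        (\<Sum>F \<in> flats M. (-1) ^ rank M F * Q (restrict M F) *
          reversal (rk (contract M F)) (char_poly (contract M F)))) \<and>
    (\<forall>M. \<not> (matroid M \<and> loopless M) \<longrightarrow> Q M = 0)"

definition inverse_KL :: "'a indep_system \<Rightarrow> int poly" where
  "inverse_KL = (THE Q. is_inverse_KL Q)"

definition inverse_Z_loopless :: "'a indep_system \<Rightarrow> int poly" where
  "inverse_Z_loopless M = (-1) ^ rk M *
    (\<Sum>F \<in> flats M. (-1) ^ rank M F * inverse_KL (restrict M F) *
      monom (mu (contract M F)) (rk (contract M F)))"

definition inverse_Z :: "'a indep_system \<Rightarrow> int poly" where
  "inverse_Z M =
    (if loopless M then inverse_Z_loopless M
     else inverse_Z_loopless (restrict M (ground M - loops M)))"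

text \<open>For a sparse paving matroid of rank 1 with a loop, on at least two elements, the loop is unique
  and is the only circuit-hyperplane, while the inverse Z-polynomial is \<open>1 + t\<close>, as for the uniform
  matroid of rank 1. The relaxation formula for the inverse Z-polynomial therefore needs the
  assumption that a matroid of rank 1 is loopless; for other ranks it needs no such assumption.\<close>

text \<open>The division is exact.\<close>

definition catalan :: "nat \<Rightarrow> nat" where
  "catalan m = ((2 * m) choose m) div (m + 1)"

end

theory Submission
  imports Defs
begin

text \<open>
  Write \<open>Y\<close> up to sign as \<open>\<Sum>F. (-1) ^ rk F * Q (M | F) * t ^ rk (M / F) * \<mu> (M / F)\<close>. Summing these
  polynomials over all restrictions \<open>M | C\<close> gives the right-hand side of the functional equation of
  \<open>Q\<close>, and summing their reversals gives its left-hand side. So the functional equation for all matroids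
  says precisely that every \<open>Y\<close> is palindromic. As \<open>Q M\<close> has degree less than \<open>rk M / 2\<close>, the
  polynomial \<open>Q M\<close> exists, is unique and is read off from the part \<open>V\<close> of the sum over
  the proper flats, and the upper half of \<open>Y\<close> is the upper half of \<open>V\<close>.

  In a sparse paving matroid of rank \<open>k\<close>, restrictions to flats with fewer than \<open>k\<close> elements are Boolean,
  with \<open>Q = 1\<close>. Compared with the uniform matroid, a circuit-hyperplane \<open>H\<close> lowers
  \<open>(-1) ^ (k - card F) * \<mu> (M / F)\<close> by one for each \<open>F \<subseteq> H\<close>, and adds \<open>t * Q (M | H)\<close>. Hence it lowers
  \<open>V\<close> by \<open>(1 + t) ^ k - 1 - t * Q (M | H)\<close>. By the degree bound, \<open>t * Q (M | H)\<close> reaches the upper half only in the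
  middle coefficient, which is a Catalan number.
\<close>

section \<open>Rank, restriction and contraction\<close>

context matroid
begin

lemma finite_indep: "X \<in> indep M \<Longrightarrow> finite X"
  using finite_ground indep_subset finite_subset by blast

lemma finite_indep_within: "finite {Y \<in> indep M. Y \<subseteq> X}"
  by (rule finite_subset[of _ "Pow (ground M)"]) (use indep_subset finite_ground in auto)

lemma card_le_rank: "I \<in> indep M \<Longrightarrow> I \<subseteq> X \<Longrightarrow> card I \<le> rank M X"
  unfolding rank_def using finite_indep_within by (intro Max_ge) auto

lemma rank_attained: "\<exists>B \<in> indep M. B \<subseteq> X \<and> card B = rank M X"
proof -
  have "Max (card ` {Y \<in> indep M. Y \<subseteq> X}) \<in> card ` {Y \<in> indep M. Y \<subseteq> X}"
    using finite_indep_within indep_empty by (intro Max_in) auto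
  then show ?thesis unfolding rank_def by (metis (no_types, lifting) imageE mem_Collect_eq)
qed

lemma rank_mono: "X \<subseteq> Y \<Longrightarrow> rank M X \<le> rank M Y"
  using rank_attained[of X] card_le_rank[of _ Y] by force

lemma rank_le_card: "finite X \<Longrightarrow> rank M X \<le> card X"
  using rank_attained[of X] card_mono by metis

lemma rank_indep: "X \<in> indep M \<Longrightarrow> rank M X = card X"
  using card_le_rank[of X X] rank_le_card[of X] finite_indep by fastforce

lemma indep_iff_rank: "finite X \<Longrightarrow> X \<in> indep M \<longleftrightarrow> rank M X = card X"
  using rank_indep rank_attained[of X] card_subset_eq by metis

text \<open>Repeated augmentation from a largest independent subset of \<open>X\<close>; the gap to
  the rank decreases at each step.\<close>

lemma extend_to_rank:
  assumes "I \<in> indep M" "I \<subseteq> X"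
  shows "\<exists>B \<in> indep M. I \<subseteq> B \<and> B \<subseteq> X \<and> card B = rank M X"
  using assms
proof (induction "rank M X - card I" arbitrary: I rule: less_induct)
  case less
  show ?case
  proof (cases "card I = rank M X")
    case False
    then have lt: "card I < rank M X" using card_le_rank[of I X] less.prems by simp
    obtain J where J: "J \<in> indep M" "J \<subseteq> X" "card J = rank M X" using rank_attained by blast
    obtain y where y: "y \<in> J - I" "insert y I \<in> indep M"
      using indep_augment[of I J] less.prems J lt by auto
    have "card (insert y I) = Suc (card I)" using y finite_indep less.prems by simp
    moreover have "insert y I \<subseteq> X" using y J less.prems by auto
    ultimately show ?thesis using less.hyps[of "insert y I"] y lt by (metis insert_subset diff_less_mono2 lessI)
  qed (use less in auto)
qed

lemma rank_Un_le: "finite Y \<Longrightarrow> rank M (X \<union> Y) \<le> rank M X + card Y"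
proof -
  assume fin: "finite Y"
  obtain B where B: "B \<in> indep M" "B \<subseteq> X \<union> Y" "card B = rank M (X \<union> Y)"
    using rank_attained by blast
  have "card B = card (B \<inter> X) + card (B - X)"
    using card_Int_Diff finite_indep B by metis
  moreover have "card (B \<inter> X) \<le> rank M X"
    using B indep_mono by (intro card_le_rank) auto
  moreover have "card (B - X) \<le> card Y" using B fin by (intro card_mono) auto
  ultimately show ?thesis using B by simp
qed

text \<open>Local submodularity. A basis \<open>A\<close> of \<open>X\<close> is extended to a basis
  \<open>B\<close> of \<open>Y\<close>; if \<open>x\<close> raised the rank of \<open>Y\<close>,
  then \<open>insert x B\<close>, and with it \<open>insert x A\<close>, would be
  independent.\<close>

lemma rank_insert_eq_mono:
  assumes "X \<subseteq> Y" "rank M (insert x X) = rank M X"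
  shows "rank M (insert x Y) = rank M Y"
proof (rule ccontr)
  assume neq: "rank M (insert x Y) \<noteq> rank M Y"
  then have lt: "rank M Y < rank M (insert x Y)"
    using rank_mono[of Y "insert x Y"] by (simp add: subset_insertI)
  obtain A where A: "A \<in> indep M" "A \<subseteq> X" "card A = rank M X" using rank_attained by blast
  obtain B where B: "B \<in> indep M" "A \<subseteq> B" "B \<subseteq> Y" "card B = rank M Y"
    using extend_to_rank[of A Y] A assms by blast
  obtain C where C: "C \<in> indep M" "C \<subseteq> insert x Y" "card C = rank M (insert x Y)"
    using rank_attained by blast
  obtain y where y: "y \<in> C - B" "insert y B \<in> indep M"
    using indep_augment[of B C] B C lt by auto
  have cy: "card (insert y B) = Suc (rank M Y)" using y B finite_indep by simp
  \<comment> \<open>Any other \<open>y\<close> lies in \<open>Y\<close>, so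
    \<open>insert y B\<close> would be too large an independent subset of \<open>Y\<close>.\<close>
  have "y = x" using card_le_rank[of "insert y B" Y] y B C cy by auto
  then have "insert x A \<in> indep M" "x \<notin> A" using y B indep_mono[of "insert y B" "insert x A"] by auto
  then show False
    using card_le_rank[of "insert x A" "insert x X"] A assms finite_indep by auto
qed

lemma rank_less_mono:
  "X \<subseteq> Y \<Longrightarrow> rank M Y < rank M (insert x Y) \<Longrightarrow> rank M X < rank M (insert x X)"
  using rank_insert_eq_mono[of X Y x] rank_mono[OF subset_insertI, of X x] by linarith

end

section \<open>Restrictions, contractions and their flats\<close>

lemma ground_restrict [simp]: "ground (restrict M F) = F"
  and ground_contract [simp]: "ground (contract M F) = ground M - F"
  by (simp_all add: restrict_def contract_def)

lemma rank_restrict: "X \<subseteq> F \<Longrightarrow> rank (restrict M F) X = rank M X"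
  unfolding rank_def restrict_def by (rule arg_cong[where f = "\<lambda>S. Max (card ` S)"]) auto

lemma rk_restrict [simp]: "rk (restrict M F) = rank M F"
  by (simp add: rk_def rank_restrict)

lemma restrict_restrict: "G \<subseteq> F \<Longrightarrow> restrict (restrict M F) G = restrict M G"
  by (auto simp: restrict_def)

lemma (in matroid) restrict_ground: "restrict M (ground M) = M"
  using indep_subset by (auto simp: restrict_def intro!: indep_system.equality)

lemma (in matroid) matroid_restrict: "F \<subseteq> ground M \<Longrightarrow> matroid (restrict M F)"
proof
  show "finite (ground (restrict M F))" if "F \<subseteq> ground M"
    using that finite_ground finite_subset by auto
  show "\<exists>y\<in>Y - X. insert y X \<in> indep (restrict M F)"
    if "X \<in> indep (restrict M F)" "Y \<in> indep (restrict M F)" "card X < card Y" for X Y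
    using indep_augment[of X Y] that by (force simp: restrict_def)
qed (use indep_empty indep_mono in \<open>auto simp: restrict_def\<close>)

lemma (in matroid) loopless_restrict: "loopless M \<Longrightarrow> F \<subseteq> ground M \<Longrightarrow> loopless (restrict M F)"
  by (auto simp: loopless_def loops_def restrict_def)

lemma flats_subset_ground: "F \<in> flats M \<Longrightarrow> F \<subseteq> ground M"
  by (simp add: flats_def flat_def)

lemma ground_in_flats: "ground M \<in> flats M"
  by (simp add: flats_def flat_def)

lemma (in matroid) finite_flats: "finite (flats M)"
  by (rule finite_subset[of _ "Pow (ground M)"])
    (use flats_subset_ground finite_ground in auto)

lemma (in matroid) finite_flat: "F \<in> flats M \<Longrightarrow> finite F"
  using flats_subset_ground finite_ground finite_subset by metis

lemma (in matroid) rank_flat_less: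
  assumes "F \<in> flats M" "F \<subset> G" "G \<subseteq> ground M"
  shows "rank M F < rank M G"
proof -
  obtain x where x: "x \<in> G - F" using assms by blast
  then have "rank M F < rank M (insert x F)" using assms by (auto simp: flats_def flat_def)
  also have "\<dots> \<le> rank M G" using assms x by (intro rank_mono) auto
  finally show ?thesis .
qed

text \<open>A point outside \<open>F\<close> raises the rank of \<open>F\<close>, hence also that of
  any smaller set \<open>G\<close>.\<close>

lemma (in matroid) flats_restrict:
  assumes "F \<in> flats M"
  shows "flats (restrict M F) = {G \<in> flats M. G \<subseteq> F}"
proof (intro equalityI subsetI)
  fix G assume "G \<in> flats (restrict M F)"
  then have G: "G \<subseteq> F" and up: "\<And>x. x \<in> F - G \<Longrightarrow> rank M G < rank M (insert x G)"
    by (auto simp: flats_def flat_def rank_restrict)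
  have "rank M G < rank M (insert x G)" if "x \<in> ground M - G" for x
  proof (cases "x \<in> F")
    case False
    then have "rank M F < rank M (insert x F)"
      using assms that by (auto simp: flats_def flat_def)
    then show ?thesis using rank_less_mono G by blast
  qed (use up that in auto)
  then show "G \<in> {G \<in> flats M. G \<subseteq> F}" using G assms by (auto simp: flats_def flat_def)
next
  fix G assume "G \<in> {G \<in> flats M. G \<subseteq> F}"
  then show "G \<in> flats (restrict M F)"
    using assms by (auto simp: flats_def flat_def rank_restrict)
qed

text \<open>The additive form avoids truncated subtraction. If a basis of \<open>F\<close> is
  extended to a basis \<open>C\<close> of \<open>X \<union> F\<close>, then \<open>C - F\<close> is
  a largest independent subset of \<open>X\<close> in the contraction.\<close>

lemma (in matroid) rank_contract:
  assumes "F \<subseteq> ground M" "X \<subseteq> ground M - F"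
  shows "rank (contract M F) X + rank M F = rank M (X \<union> F)"
proof -
  let ?S = "{Y \<in> indep (contract M F). Y \<subseteq> X}"
  have finX: "finite X" using assms finite_ground finite_subset by blast
  then have fin: "finite ?S" by (auto intro: finite_subset[of _ "Pow X"])
  obtain B where B: "B \<in> indep M" "B \<subseteq> F" "card B = rank M F" using rank_attained by blast
  obtain C where C: "C \<in> indep M" "B \<subseteq> C" "C \<subseteq> X \<union> F" "card C = rank M (X \<union> F)"
    using extend_to_rank[of B "X \<union> F"] B by blast
  have finC: "finite C" using C finite_indep by blast
  have "card (C \<inter> F) \<le> rank M F" using C indep_mono by (intro card_le_rank) auto
  then have CF: "C \<inter> F = B"
    using B C finC by (intro card_seteq[symmetric]) auto
  have cC: "card C = card (C - F) + rank M F"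
    using card_Int_Diff[OF finC, of F] CF B by simp
  have "rank M (C - F \<union> F) \<le> rank M F + card (C - F)"
    using rank_Un_le[of "C - F" F] finC by (simp add: Un_commute)
  moreover have "card C \<le> rank M (C - F \<union> F)" using C by (intro card_le_rank) auto
  ultimately have "C - F \<in> ?S" using cC C assms by (auto simp: contract_def)
  moreover have "card Y \<le> card (C - F)" if "Y \<in> ?S" for Y
  proof -
    have "card Y + rank M F = rank M (Y \<union> F)" "Y \<subseteq> X" using that by (auto simp: contract_def)
    moreover have "rank M (Y \<union> F) \<le> rank M (X \<union> F)" using \<open>Y \<subseteq> X\<close> by (intro rank_mono) auto
    ultimately show ?thesis using C cC by linarith
  qed
  ultimately have "rank (contract M F) X = card (C - F)"
    unfolding rank_def using fin by (intro Max_eqI) auto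
  then show ?thesis using cC C by simp
qed

lemma (in matroid) rk_contract: "F \<subseteq> ground M \<Longrightarrow> rk (contract M F) = rk M - rank M F"
  using rank_contract[of F "ground M - F"] by (simp add: rk_def Un_absorb2)

lemma (in matroid) contract_contract:
  assumes "F \<subseteq> G" "G \<subseteq> ground M"
  shows "contract (contract M F) (G - F) = contract M G"
proof -
  have sets: "X \<union> (G - F) \<union> F = X \<union> G" "G - F \<union> F = G" for X using assms by auto
  have "rank (contract M F) (X \<union> (G - F)) = card X + rank (contract M F) (G - F)
      \<longleftrightarrow> rank M (X \<union> G) = card X + rank M G" if "X \<subseteq> ground M - G" for X
  proof -
    have "F \<subseteq> ground M" "X \<union> (G - F) \<subseteq> ground M - F" "G - F \<subseteq> ground M - F"
      using that assms by auto
    then show ?thesis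
      using rank_contract[of F "X \<union> (G - F)"] rank_contract[of F "G - F"] sets by simp linarith
  qed
  moreover have "ground M - F - (G - F) = ground M - G" using assms by auto
  ultimately show ?thesis unfolding contract_def[of _ G] contract_def[of _ "G - F"] by auto
qed

lemma (in matroid) restrict_contract:
  assumes "F \<subseteq> G" "G \<subseteq> ground M"
  shows "restrict (contract M F) (G - F) = contract (restrict M G) F"
proof -
  have "rank (restrict M G) (X \<union> F) = rank M (X \<union> F)" if "X \<subseteq> G - F" for X
    using that assms by (intro rank_restrict) auto
  moreover have "rank (restrict M G) F = rank M F" using assms by (intro rank_restrict)
  ultimately show ?thesis
    unfolding contract_def restrict_def[of _ "G - F"] using assms by auto
qed

text \<open>Adding \<open>F\<close> back shifts all ranks by the constant \<open>rank M F\<close>,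
  so the strict increases that define flats are preserved.\<close>

lemma (in matroid) flats_contract:
  assumes "F \<subseteq> ground M"
  shows "flats (contract M F) = (\<lambda>G. G - F) ` {G \<in> flats M. F \<subseteq> G}"
proof -
  have key: "G - F \<in> flats (contract M F) \<longleftrightarrow> G \<in> flats M" if "F \<subseteq> G" "G \<subseteq> ground M" for G
  proof -
    have "rank (contract M F) (G - F) < rank (contract M F) (insert x (G - F))
      \<longleftrightarrow> rank M G < rank M (insert x G)" if x: "x \<in> ground M - G" for x
    proof -
      have "rank (contract M F) (G - F) + rank M F = rank M G"
        using rank_contract[of F "G - F"] \<open>F \<subseteq> G\<close> \<open>G \<subseteq> ground M\<close> assms by (simp add: Un_absorb2 Diff_mono)
      moreover have "rank (contract M F) (insert x (G - F)) + rank M F = rank M (insert x G)"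
        using rank_contract[of F "insert x (G - F)"] \<open>F \<subseteq> G\<close> \<open>G \<subseteq> ground M\<close> assms x
        by (auto simp: Un_absorb2)
      ultimately show ?thesis by linarith
    qed
    moreover have "ground M - F - (G - F) = ground M - G" "G - F \<subseteq> ground M - F" using that by auto
    ultimately show ?thesis using that by (simp add: flats_def flat_def)
  qed
  show ?thesis
  proof (intro equalityI subsetI)
    fix H assume H: "H \<in> flats (contract M F)"
    then have "H \<subseteq> ground M - F" using flats_subset_ground by fastforce
    then have "H = (H \<union> F) - F" "F \<subseteq> H \<union> F" "H \<union> F \<subseteq> ground M" using assms by auto
    then show "H \<in> (\<lambda>G. G - F) ` {G \<in> flats M. F \<subseteq> G}"
      using key[of "H \<union> F"] H by (metis (mono_tags, lifting) image_eqI mem_Collect_eq)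
  qed (use key flats_subset_ground in auto)
qed

section \<open>The Moebius function of a lattice of flats\<close>

lemma moebius_self [simp]: "moebius L A A = 1"
  by (simp add: moebius.simps)

lemma moebius_sum:
  assumes "A \<in> L" "B \<in> L" "A \<subseteq> B" "finite B"
  shows "(\<Sum>C \<in> {C \<in> L. A \<subseteq> C \<and> C \<subseteq> B}. moebius L A C) = (if A = B then 1 else 0)"
proof (cases "A = B")
  case True
  then have "{C \<in> L. A \<subseteq> C \<and> C \<subseteq> B} = {B}" using assms by auto
  then show ?thesis using True by simp
next
  case False
  have "{C \<in> L. A \<subseteq> C \<and> C \<subseteq> B} = insert B {C \<in> L. A \<subseteq> C \<and> C \<subset> B}" using assms by auto
  moreover have "finite {C \<in> L. A \<subseteq> C \<and> C \<subset> B}"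
    by (rule finite_subset[of _ "Pow B"]) (use assms in auto)
  moreover have "moebius L A B = - (\<Sum>C \<in> {C \<in> L. A \<subseteq> C \<and> C \<subset> B}. moebius L A C)"
    using False assms by (simp add: moebius.simps[of L A B] psubset_eq)
  ultimately show ?thesis using False by simp
qed

text \<open>The value depends only on the isomorphism type of the interval. It is applied with
  \<open>f\<close> the removal of \<open>F\<close> for contractions and the identity for
  restrictions.\<close>

lemma moebius_image:
  assumes "\<And>C. C \<in> L \<Longrightarrow> A \<subseteq> C \<Longrightarrow> C \<subseteq> B \<Longrightarrow> f C \<in> L'"
    and "\<And>D. D \<in> L' \<Longrightarrow> f A \<subseteq> D \<Longrightarrow> D \<subseteq> f B \<Longrightarrow> \<exists>C \<in> L. A \<subseteq> C \<and> C \<subseteq> B \<and> f C = D"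
    and "\<And>C D. A \<subseteq> C \<Longrightarrow> C \<subseteq> B \<Longrightarrow> A \<subseteq> D \<Longrightarrow> D \<subseteq> B \<Longrightarrow> f C \<subseteq> f D \<longleftrightarrow> C \<subseteq> D"
    and "A \<subseteq> B" "finite B" "finite (f B)"
  shows "moebius L' (f A) (f B) = moebius L A B"
  using assms
proof (induction "card B" arbitrary: B rule: less_induct)
  case less
  note emb = less.prems(3) and AB = less.prems(4) and fin = less.prems(5,6)
  show ?case
  proof (cases "A = B")
    case False
    have lt: "f C \<subset> f D \<longleftrightarrow> C \<subset> D" if "A \<subseteq> C" "C \<subseteq> B" "A \<subseteq> D" "D \<subseteq> B" for C D
      using emb[of C D] emb[of D C] that by blast
    have IH: "moebius L' (f A) (f C) = moebius L A C" if "A \<subseteq> C" "C \<subset> B" for C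
    proof (rule less.hyps)
      show "card C < card B" using that fin by (intro psubset_card_mono)
      show "f D \<in> L'" if "D \<in> L" "A \<subseteq> D" "D \<subseteq> C" for D
        using less.prems(1)[of D] that \<open>C \<subset> B\<close> by auto
      show "\<exists>D'\<in>L. A \<subseteq> D' \<and> D' \<subseteq> C \<and> f D' = D" if D: "D \<in> L'" "f A \<subseteq> D" "D \<subseteq> f C" for D
      proof -
        have "f C \<subseteq> f B" using emb[of C B] \<open>A \<subseteq> C\<close> \<open>C \<subset> B\<close> AB by auto
        then obtain D' where D': "D' \<in> L" "A \<subseteq> D'" "D' \<subseteq> B" "f D' = D"
          using less.prems(2)[of D] D by auto
        then have "D' \<subseteq> C" using emb[of D' C] \<open>A \<subseteq> C\<close> \<open>C \<subset> B\<close> D by auto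
        then show ?thesis using D' by blast
      qed
      show "f D \<subseteq> f D' \<longleftrightarrow> D \<subseteq> D'" if "A \<subseteq> D" "D \<subseteq> C" "A \<subseteq> D'" "D' \<subseteq> C" for D D'
        using emb[of D D'] that \<open>C \<subset> B\<close> by auto
      show "finite C" using that fin finite_subset by blast
      show "finite (f C)" using lt[of C B] that AB fin finite_subset[of "f C" "f B"] by blast
    qed (use that in auto)
    have inj: "inj_on f {C \<in> L. A \<subseteq> C \<and> C \<subset> B}"
    proof (rule inj_onI)
      fix C D assume "C \<in> {C \<in> L. A \<subseteq> C \<and> C \<subset> B}" "D \<in> {C \<in> L. A \<subseteq> C \<and> C \<subset> B}" "f C = f D"
      then show "C = D" using emb[of C D] emb[of D C] by blast
    qed
    have img: "{D \<in> L'. f A \<subseteq> D \<and> D \<subset> f B} = f ` {C \<in> L. A \<subseteq> C \<and> C \<subset> B}"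
    proof (intro equalityI subsetI)
      fix D assume D: "D \<in> {D \<in> L'. f A \<subseteq> D \<and> D \<subset> f B}"
      then obtain C where C: "C \<in> L" "A \<subseteq> C" "C \<subseteq> B" "f C = D" using less.prems(2)[of D] by auto
      then have "C \<subset> B" using D by blast
      then show "D \<in> f ` {C \<in> L. A \<subseteq> C \<and> C \<subset> B}" using C by auto
    next
      fix D assume "D \<in> f ` {C \<in> L. A \<subseteq> C \<and> C \<subset> B}"
      then obtain C where C: "C \<in> L" "A \<subseteq> C" "C \<subset> B" "f C = D" by auto
      then show "D \<in> {D \<in> L'. f A \<subseteq> D \<and> D \<subset> f B}"
        using less.prems(1)[of C] emb[of A C] lt[of C B] AB by auto
    qed
    have "moebius L' (f A) (f B) = - (\<Sum>D \<in> {D \<in> L'. f A \<subseteq> D \<and> D \<subset> f B}. moebius L' (f A) D)"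
      using False lt[of A B] AB fin by (simp add: moebius.simps[of L' "f A" "f B"] psubset_eq)
    also have "\<dots> = - (\<Sum>C \<in> {C \<in> L. A \<subseteq> C \<and> C \<subset> B}. moebius L A C)"
      unfolding img by (subst sum.reindex[OF inj]) (auto intro!: sum.cong simp: IH)
    also have "\<dots> = moebius L A B"
      using False AB fin by (simp add: moebius.simps[of L A B] psubset_eq)
    finally show ?thesis .
  qed simp
qed

lemma (in matroid) mu_contract:
  assumes "F \<in> flats M"
  shows "mu (contract M F) = moebius (flats M) F (ground M)"
proof -
  have sub: "F \<subseteq> ground M" using assms flats_subset_ground by blast
  have "moebius (flats (contract M F)) (F - F) (ground M - F) = moebius (flats M) F (ground M)"
  proof (rule moebius_image)
    show "\<exists>C\<in>flats M. F \<subseteq> C \<and> C \<subseteq> ground M \<and> C - F = D" if "D \<in> flats (contract M F)" for D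
      using that flats_subset_ground unfolding flats_contract[OF sub] by blast
    show "C - F \<subseteq> D - F \<longleftrightarrow> C \<subseteq> D" if "F \<subseteq> C" "F \<subseteq> D" for C D using that by blast
    show "C - F \<in> flats (contract M F)" if "C \<in> flats M" "F \<subseteq> C" for C
      using that unfolding flats_contract[OF sub] by blast
    show "finite (ground M - F)" using finite_ground by simp
  qed (use sub finite_ground in simp_all)
  then show ?thesis by (simp add: mu_def)
qed

lemma (in matroid) mu_contract_restrict:
  assumes "F \<in> flats M" "G \<in> flats M" "F \<subseteq> G"
  shows "mu (contract (restrict M G) F) = moebius (flats M) F G"
proof -
  interpret R: matroid "restrict M G" using assms by (intro matroid_restrict flats_subset_ground)
  have "mu (contract (restrict M G) F) = moebius (flats (restrict M G)) F G"
    using R.mu_contract[of F] assms by (simp add: flats_restrict)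
  also have "\<dots> = moebius (flats M) F G"
    by (rule moebius_image[where f = "\<lambda>C. C"])
      (use assms finite_flat in \<open>simp_all add: flats_restrict\<close>)
  finally show ?thesis .
qed

section \<open>The functional equation as palindromicity\<close>

lemma coeff_reversal: "coeff (reversal r p) i = (if i \<le> r then coeff p (r - i) else 0)"
proof -
  have "coeff (reversal r p) i = (\<Sum>j\<le>r. if i \<le> r \<and> j = r - i then coeff p j else 0)"
    unfolding reversal_def coeff_sum coeff_monom by (intro sum.cong) auto
  also have "\<dots> = (if i \<le> r then coeff p (r - i) else 0)"
    by (cases "i \<le> r") (simp_all add: sum.delta)
  finally show ?thesis .
qed

lemma reversal_add: "reversal r (p + q) = reversal r p + reversal r q"
  by (rule poly_eqI) (simp add: coeff_reversal)

lemma reversal_0 [simp]: "reversal r 0 = 0"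
  by (rule poly_eqI) (simp add: coeff_reversal)

lemma reversal_sum: "reversal r (sum f A) = (\<Sum>x\<in>A. reversal r (f x))"
  by (induction A rule: infinite_finite_induct) (simp_all add: reversal_add)

lemma reversal_monom: "m \<le> r \<Longrightarrow> reversal r (monom c m) = monom c (r - m)"
  by (rule poly_eqI) (auto simp: coeff_reversal)

lemma coeff_mult_monom: "coeff (p * monom c m) i = (if m \<le> i then c * coeff p (i - m) else 0)"
  for c :: "'b::comm_semiring_1"
  by (subst mult.commute) (simp add: coeff_monom_mult)

lemma reversal_mult_monom:
  "m \<le> r \<Longrightarrow> reversal r (p * monom c m) = smult c (reversal (r - m) p)"
  by (rule poly_eqI) (auto simp: coeff_reversal coeff_mult_monom add.commute)

lemma coeff_signed: "coeff ((-1) ^ n * p) i = (-1) ^ n * coeff p i"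
  for p :: "'b::comm_ring_1 poly"
  by (cases "even n") simp_all

lemma reversal_signed: "reversal r ((-1) ^ n * p) = (-1) ^ n * reversal r p"
  for p :: "'b::comm_ring_1 poly"
  by (rule poly_eqI) (simp add: coeff_reversal coeff_signed)

lemma signed_cancel: "(-1) ^ n * p = (-1) ^ n * q \<longleftrightarrow> p = q"
  for p :: "'b::comm_ring_1 poly"
  by (cases "even n") simp_all

section \<open>Sums over flats for an arbitrary assignment \<open>Q\<close>\<close>

definition Y_term :: "('a indep_system \<Rightarrow> int poly) \<Rightarrow> 'a indep_system \<Rightarrow> 'a set \<Rightarrow> int poly" where
  "Y_term Q M F = (-1) ^ rank M F * Q (restrict M F) * monom (mu (contract M F)) (rk (contract M F))"

text \<open>\<open>Q\<close> is arbitrary, so that these sums are available before the inverse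
  Kazhdan-Lusztig polynomial is known to exist. The outer sign of the inverse Z-polynomial is left
  out; it does not affect palindromicity.\<close>

definition Y_sum :: "('a indep_system \<Rightarrow> int poly) \<Rightarrow> 'a indep_system \<Rightarrow> int poly" where
  "Y_sum Q M = (\<Sum>F \<in> flats M. Y_term Q M F)"

text \<open>Here the outer sign is included: this is the polynomial \<open>V\<close> to which
  \<open>Q M\<close> is added.\<close>

definition Y_proper :: "('a indep_system \<Rightarrow> int poly) \<Rightarrow> 'a indep_system \<Rightarrow> int poly" where
  "Y_proper Q M = (-1) ^ rk M * (\<Sum>F \<in> flats M - {ground M}. Y_term Q M F)"

definition KL_equation :: "('a indep_system \<Rightarrow> int poly) \<Rightarrow> 'a indep_system \<Rightarrow> bool" where
  "KL_equation Q M \<longleftrightarrow> (-1) ^ rk M * reversal (rk M) (Q M) =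
    (\<Sum>F \<in> flats M. (-1) ^ rank M F * Q (restrict M F) *
      reversal (rk (contract M F)) (char_poly (contract M F)))"

definition palindromic :: "nat \<Rightarrow> int poly \<Rightarrow> bool" where
  "palindromic r p \<longleftrightarrow> reversal r p = p"

lemma palindromic_signed: "palindromic r ((-1) ^ n * p) \<longleftrightarrow> palindromic r p"
  by (simp add: palindromic_def reversal_signed signed_cancel)

context matroid
begin

text \<open>The flats and minors of \<open>contract M F\<close> are all translated to the interval
  above \<open>F\<close> in \<open>flats M\<close>, so that sums over different \<open>F\<close> can
  be interchanged.\<close>

lemma char_poly_contract:
  assumes F: "F \<in> flats M"
  shows "char_poly (contract M F) =
    (\<Sum>G \<in> {G \<in> flats M. F \<subseteq> G}. monom (moebius (flats M) F G) (rk M - rank M G))"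
proof -
  have sub: "F \<subseteq> ground M" using F by (rule flats_subset_ground)
  have inj: "inj_on (\<lambda>G. G - F) {G \<in> flats M. F \<subseteq> G}" by (rule inj_onI) blast
  have "mu (restrict (contract M F) (G - F)) = moebius (flats M) F G
      \<and> rk (contract (contract M F) (G - F)) = rk M - rank M G"
    if "G \<in> flats M" "F \<subseteq> G" for G
    using that F flats_subset_ground[of G M]
    by (simp add: restrict_contract contract_contract rk_contract mu_contract_restrict)
  then show ?thesis
    unfolding char_poly_def flats_contract[OF sub] by (simp add: sum.reindex[OF inj])
qed

lemma rank_le_rk: "F \<subseteq> ground M \<Longrightarrow> rank M F \<le> rk M"
  unfolding rk_def by (rule rank_mono)

lemma Y_term_eq:
  "F \<in> flats M \<Longrightarrow> Y_term Q M F =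
    (-1) ^ rank M F * Q (restrict M F) * monom (moebius (flats M) F (ground M)) (rk M - rank M F)"
  by (simp add: Y_term_def mu_contract rk_contract flats_subset_ground)

lemma Y_term_restrict:
  assumes "F \<in> flats M" "G \<in> flats M" "F \<subseteq> G"
  shows "Y_term Q (restrict M G) F =
    (-1) ^ rank M F * Q (restrict M F) * monom (moebius (flats M) F G) (rank M G - rank M F)"
proof -
  interpret R: matroid "restrict M G" using assms by (intro matroid_restrict flats_subset_ground)
  show ?thesis
    using assms by (simp add: Y_term_def R.rk_contract rank_restrict restrict_restrict mu_contract_restrict)
qed

lemma Y_sum_restrict:
  assumes "G \<in> flats M"
  shows "Y_sum Q (restrict M G) = (\<Sum>F \<in> {F \<in> flats M. F \<subseteq> G}.
    (-1) ^ rank M F * Q (restrict M F) * monom (moebius (flats M) F G) (rank M G - rank M F))"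
  unfolding Y_sum_def flats_restrict[OF assms] using assms by (intro sum.cong) (simp_all add: Y_term_restrict)

text \<open>Reversal turns the exponent \<open>rk M - rank M G\<close> into
  \<open>rank M G - rank M F\<close>, the exponent in the term of \<open>F\<close> for the
  restriction to \<open>G\<close>. It remains to interchange the sums over pairs
  \<open>F \<subseteq> G\<close>.\<close>

lemma sum_Y_sum_restrict:
  "(\<Sum>G \<in> flats M. Y_sum Q (restrict M G)) =
    (\<Sum>F \<in> flats M. (-1) ^ rank M F * Q (restrict M F) *
      reversal (rk (contract M F)) (char_poly (contract M F)))"
proof -
  have "reversal (rk (contract M F)) (char_poly (contract M F)) =
      (\<Sum>G \<in> {G \<in> flats M. F \<subseteq> G}. monom (moebius (flats M) F G) (rank M G - rank M F))"
    if F: "F \<in> flats M" for F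
    unfolding char_poly_contract[OF F] reversal_sum
  proof (intro sum.cong refl)
    fix G assume "G \<in> {G \<in> flats M. F \<subseteq> G}"
    then have "rank M F \<le> rank M G" "rank M G \<le> rk M"
      using rank_le_rk[of G] flats_subset_ground[of G M] by (auto intro: rank_mono)
    then show "reversal (rk (contract M F)) (monom (moebius (flats M) F G) (rk M - rank M G)) =
        monom (moebius (flats M) F G) (rank M G - rank M F)"
      using F by (subst reversal_monom) (simp_all add: rk_contract flats_subset_ground)
  qed
  then have "(\<Sum>F \<in> flats M. (-1) ^ rank M F * Q (restrict M F) *
      reversal (rk (contract M F)) (char_poly (contract M F))) =
    (\<Sum>F \<in> flats M. \<Sum>G \<in> {G \<in> flats M. F \<subseteq> G}. (-1) ^ rank M F * Q (restrict M F) *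
      monom (moebius (flats M) F G) (rank M G - rank M F))"
    by (simp add: sum_distrib_left)
  also have "\<dots> = (\<Sum>G \<in> flats M. \<Sum>F \<in> {F \<in> flats M. F \<subseteq> G}. (-1) ^ rank M F * Q (restrict M F) *
      monom (moebius (flats M) F G) (rank M G - rank M F))"
    by (rule sum.swap_restrict[OF finite_flats finite_flats])
  also have "\<dots> = (\<Sum>G \<in> flats M. Y_sum Q (restrict M G))"
    by (simp add: Y_sum_restrict)
  finally show ?thesis by simp
qed

text \<open>The reversal turns the powers of \<open>t\<close> into constants, so that the defining recursion of the
  Moebius function leaves only the top flat.\<close>

lemma sum_reversal_Y_sum_restrict:
  "(\<Sum>G \<in> flats M. reversal (rank M G) (Y_sum Q (restrict M G))) = (-1) ^ rk M * reversal (rk M) (Q M)"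
proof -
  have "reversal (rank M G) (Y_sum Q (restrict M G)) = (\<Sum>F \<in> {F \<in> flats M. F \<subseteq> G}.
      (-1) ^ rank M F * reversal (rank M F) (Q (restrict M F)) * [:moebius (flats M) F G:])"
    if G: "G \<in> flats M" for G
    unfolding Y_sum_restrict[OF G] reversal_sum
  proof (intro sum.cong refl)
    fix F assume "F \<in> {F \<in> flats M. F \<subseteq> G}"
    then have "rank M F \<le> rank M G" by (auto intro: rank_mono)
    then show "reversal (rank M G) ((-1) ^ rank M F * Q (restrict M F) *
          monom (moebius (flats M) F G) (rank M G - rank M F)) =
        (-1) ^ rank M F * reversal (rank M F) (Q (restrict M F)) * [:moebius (flats M) F G:]"
      by (simp add: reversal_mult_monom reversal_signed mult.commute[of _ "[:moebius (flats M) F G:]"])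
  qed
  then have "(\<Sum>G \<in> flats M. reversal (rank M G) (Y_sum Q (restrict M G))) =
     (\<Sum>G \<in> flats M. \<Sum>F \<in> {F \<in> flats M. F \<subseteq> G}.
      (-1) ^ rank M F * reversal (rank M F) (Q (restrict M F)) * [:moebius (flats M) F G:])"
    by simp
  also have "\<dots> = (\<Sum>F \<in> flats M. \<Sum>G \<in> {G \<in> flats M. F \<subseteq> G}.
      (-1) ^ rank M F * reversal (rank M F) (Q (restrict M F)) * [:moebius (flats M) F G:])"
    by (rule sum.swap_restrict[OF finite_flats finite_flats])
  also have "\<dots> = (\<Sum>F \<in> flats M. (-1) ^ rank M F * reversal (rank M F) (Q (restrict M F)) *
      [:\<Sum>G \<in> {G \<in> flats M. F \<subseteq> G}. moebius (flats M) F G:])"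
  proof -
    have const_sum: "(\<Sum>x\<in>A. [:f x:]) = [:sum f A:]" for f :: "'a set \<Rightarrow> int" and A
      by (induction A rule: infinite_finite_induct) simp_all
    show ?thesis by (simp only: sum_distrib_left[symmetric] const_sum)
  qed
  also have "\<dots> = (\<Sum>F \<in> flats M. if F = ground M then (-1) ^ rk M * reversal (rk M) (Q M) else 0)"
  proof (intro sum.cong refl)
    fix F assume F: "F \<in> flats M"
    have "{G \<in> flats M. F \<subseteq> G} = {G \<in> flats M. F \<subseteq> G \<and> G \<subseteq> ground M}"
      using flats_subset_ground by blast
    then have "(\<Sum>G \<in> {G \<in> flats M. F \<subseteq> G}. moebius (flats M) F G) = (if F = ground M then 1 else 0)"
      using moebius_sum[of F "flats M" "ground M"] F ground_in_flats flats_subset_ground finite_ground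
      by metis
    then show "(-1) ^ rank M F * reversal (rank M F) (Q (restrict M F)) *
        [:\<Sum>G \<in> {G \<in> flats M. F \<subseteq> G}. moebius (flats M) F G:] =
        (if F = ground M then (-1) ^ rk M * reversal (rk M) (Q M) else 0)"
      by (simp add: restrict_ground rk_def)
  qed
  also have "\<dots> = (-1) ^ rk M * reversal (rk M) (Q M)"
    using finite_flats ground_in_flats[of M] by (simp add: sum.delta)
  finally show ?thesis .
qed

text \<open>By the two preceding sums, the equation says that the polynomials
  \<open>Y_sum Q (restrict M G)\<close> and their reversals have the same total. The proper flats
  cancel by hypothesis and leave the ground set.\<close>

lemma KL_equation_iff_palindromic:
  assumes "\<And>F. F \<in> flats M \<Longrightarrow> F \<noteq> ground M \<Longrightarrow> palindromic (rank M F) (Y_sum Q (restrict M F))"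
  shows "KL_equation Q M \<longleftrightarrow> palindromic (rk M) (Y_sum Q M)"
proof -
  have split: "(\<Sum>G \<in> flats M. f G) = f (ground M) + (\<Sum>G \<in> flats M - {ground M}. f G)"
    for f :: "'a set \<Rightarrow> int poly"
    using finite_flats ground_in_flats by (rule sum.remove)
  have "(\<Sum>G \<in> flats M - {ground M}. reversal (rank M G) (Y_sum Q (restrict M G))) =
      (\<Sum>G \<in> flats M - {ground M}. Y_sum Q (restrict M G))"
    using assms by (intro sum.cong) (auto simp: palindromic_def)
  then show ?thesis
    unfolding KL_equation_def sum_Y_sum_restrict[symmetric] sum_reversal_Y_sum_restrict[symmetric]
    unfolding split by (simp add: palindromic_def restrict_ground rk_def)
qed

text \<open>The top flat has Moebius value 1 and contributes \<open>Q M\<close> up to a sign, which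
  the outer sign cancels.\<close>

lemma Y_sum_eq: "(-1) ^ rk M * Y_sum Q M = Y_proper Q M + Q M"
proof -
  have "Y_term Q M (ground M) = (-1) ^ rk M * Q M"
    by (simp add: Y_term_eq ground_in_flats restrict_ground rk_def monom_0)
  moreover have "Y_sum Q M = Y_term Q M (ground M) + (\<Sum>F \<in> flats M - {ground M}. Y_term Q M F)"
    unfolding Y_sum_def using finite_flats ground_in_flats by (rule sum.remove)
  ultimately show ?thesis
    by (simp add: Y_proper_def distrib_left mult.assoc[symmetric] power_add[symmetric])
qed

text \<open>The two signs merge into \<open>(-1) ^ (rk M - rank M F)\<close>, the normalisation in
  which \<open>moebius_low_top\<close> evaluates the Moebius function.\<close>

lemma Y_proper_eq:
  "Y_proper Q M = (\<Sum>F \<in> flats M - {ground M}. Q (restrict M F) *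
    monom ((-1) ^ (rk M - rank M F) * moebius (flats M) F (ground M)) (rk M - rank M F))"
  unfolding Y_proper_def sum_distrib_left
proof (intro sum.cong refl)
  fix F assume F: "F \<in> flats M - {ground M}"
  then have "rank M F \<le> rk M" using rank_le_rk flats_subset_ground by blast
  then have "(-1) ^ rk M * (-1) ^ rank M F = ((-1) ^ (rk M - rank M F) :: int)"
    by (simp add: uminus_power_if)
  moreover have "(-1) ^ m * monom c j = monom ((-1) ^ m * c) j" for m j and c :: int
    by (rule poly_eqI) (simp add: coeff_signed)
  ultimately show "(-1) ^ rk M * Y_term Q M F = Q (restrict M F) *
    monom ((-1) ^ (rk M - rank M F) * moebius (flats M) F (ground M)) (rk M - rank M F)"
    using F by (simp only: Y_term_eq DiffD1 mult.assoc mult.left_commute[of _ "Q (restrict M F)"])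
      (simp only: mult.assoc[symmetric])
qed

end

lemma Y_proper_cong:
  assumes "\<And>F. F \<in> flats M \<Longrightarrow> F \<noteq> ground M \<Longrightarrow> Q (restrict M F) = Q' (restrict M F)"
  shows "Y_proper Q M = Y_proper Q' M"
  unfolding Y_proper_def Y_term_def using assms by (intro arg_cong2[where f = "(*)"] sum.cong) auto

text \<open>In positive rank, \<open>Q M\<close> is the correction of degree below half the rank
  that makes the signed sum over proper flats palindromic.\<close>

definition is_low_part :: "('a indep_system \<Rightarrow> int poly) \<Rightarrow> 'a indep_system \<Rightarrow> bool" where
  "is_low_part Q M \<longleftrightarrow> (rk M = 0 \<longrightarrow> Q M = 1) \<and> (0 < rk M \<longrightarrow> 2 * degree (Q M) < rk M) \<and>
    palindromic (rk M) (Y_sum Q M)"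

lemma proper_flat_minor:
  assumes "matroid M" "loopless M" "F \<in> flats M" "F \<noteq> ground M"
  shows "matroid (restrict M F)" "loopless (restrict M F)" "card F < card (ground M)"
proof -
  interpret matroid M by fact
  have "F \<subset> ground M" using assms flats_subset_ground by blast
  then show "matroid (restrict M F)" "loopless (restrict M F)" "card F < card (ground M)"
    using assms finite_ground by (auto intro!: matroid_restrict loopless_restrict psubset_card_mono)
qed

text \<open>The equivalence for one \<open>M\<close> presupposes palindromicity on its proper flats,
  so passing from the equation to palindromicity is an induction on the size of the ground
  set.\<close>

lemma is_inverse_KL_iff:
  "is_inverse_KL Q \<longleftrightarrow> (\<forall>M. matroid M \<and> loopless M \<longrightarrow> is_low_part Q M) \<and>
    (\<forall>M. \<not> (matroid M \<and> loopless M) \<longrightarrow> Q M = 0)"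
proof -
  have minor: "matroid (restrict M F) \<and> loopless (restrict M F) \<and> card F < card (ground M)"
    if "matroid M" "loopless M" "F \<in> flats M" "F \<noteq> ground M" for M :: "'a indep_system" and F
    using proper_flat_minor[OF that] by blast
  have pal: "palindromic (rk M) (Y_sum Q M)"
    if eq: "\<And>M. matroid M \<Longrightarrow> loopless M \<Longrightarrow> KL_equation Q M" and M: "matroid M" "loopless M"
    for M :: "'a indep_system"
    using M
  proof (induction "card (ground M)" arbitrary: M rule: less_induct)
    case less
    then show ?case
      using matroid.KL_equation_iff_palindromic[of M Q] eq minor[of M]
      by (metis ground_restrict rk_restrict)
  qed
  have "(\<forall>M. matroid M \<and> loopless M \<longrightarrow> KL_equation Q M) \<longleftrightarrow>
      (\<forall>M. matroid M \<and> loopless M \<longrightarrow> palindromic (rk M) (Y_sum Q M))"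
    using pal matroid.KL_equation_iff_palindromic[of _ Q] minor by (metis rk_restrict)
  then show ?thesis
    unfolding is_inverse_KL_def is_low_part_def KL_equation_def[symmetric] by blast
qed

text \<open>Compare the coefficients at \<open>i\<close> and \<open>rk M - i\<close> of the
  palindromic \<open>Y_proper Q M + Q M\<close>. Below the middle, the mirrored coefficient of
  \<open>Q M\<close> vanishes by the degree bound.\<close>

lemma coeff_low_part:
  assumes "matroid M" "is_low_part Q M" "0 < rk M"
  shows "coeff (Q M) i =
    (if 2 * i < rk M then coeff (Y_proper Q M) (rk M - i) - coeff (Y_proper Q M) i else 0)"
proof -
  have high: "coeff (Q M) j = 0" if "rk M \<le> 2 * j" for j
    using assms that by (intro coeff_eq_0) (auto simp: is_low_part_def)
  have "palindromic (rk M) (Y_proper Q M + Q M)"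
    using assms by (simp add: is_low_part_def matroid.Y_sum_eq[symmetric] palindromic_signed)
  then have "coeff (Y_proper Q M + Q M) i = coeff (reversal (rk M) (Y_proper Q M + Q M)) i"
    by (simp add: palindromic_def)
  then show ?thesis using high[of "rk M - i"] high[of i] by (auto simp: coeff_reversal)
qed

section \<open>Existence and uniqueness of the inverse Kazhdan--Lusztig polynomial\<close>

lemma low_part_unique:
  assumes "\<And>M. matroid M \<Longrightarrow> loopless M \<Longrightarrow> is_low_part Q M"
    and "\<And>M. matroid M \<Longrightarrow> loopless M \<Longrightarrow> is_low_part Q' M"
    and "matroid M" "loopless M"
  shows "Q M = Q' M"
  using assms(3,4)
proof (induction "card (ground M)" arbitrary: M rule: less_induct)
  case less
  have "Y_proper Q M = Y_proper Q' M"
    using less.hyps proper_flat_minor[of M] less.prems by (intro Y_proper_cong) simp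
  then have "Q M = Q' M" if "0 < rk M"
    using coeff_low_part[of M Q] coeff_low_part[of M Q'] assms(1,2) less.prems that
    by (intro poly_eqI) simp
  moreover have "Q M = Q' M" if "rk M = 0"
    using assms(1,2)[OF less.prems] that by (simp add: is_low_part_def)
  ultimately show ?case by blast
qed

text \<open>The formula of \<open>coeff_low_part\<close> read as a recursion.
  \<open>Y_proper\<close> is written out so that termination sees the recursive calls on proper
  flats only; 0 is the value prescribed outside the loopless matroids.\<close>

function low_part :: "'a indep_system \<Rightarrow> int poly" where
  "low_part M = (if matroid M \<and> loopless M then
    if rk M = 0 then 1 else
      let V = (-1) ^ rk M * (\<Sum>F \<in> flats M - {ground M}.
        (-1) ^ rank M F * low_part (restrict M F) * monom (mu (contract M F)) (rk (contract M F)))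
      in \<Sum>i \<in> {i. 2 * i < rk M}. monom (coeff V (rk M - i) - coeff V i) i
    else 0)"
  by auto
termination
  by (relation "measure (\<lambda>M. card (ground M))") (auto intro: proper_flat_minor(3))

declare low_part.simps [simp del]

lemma low_part_eq:
  assumes "matroid M" "loopless M" "0 < rk M"
  shows "low_part M = (\<Sum>i \<in> {i. 2 * i < rk M}.
    monom (coeff (Y_proper low_part M) (rk M - i) - coeff (Y_proper low_part M) i) i)"
  unfolding Y_proper_def Y_term_def using assms by (subst low_part.simps) (simp add: Let_def)

lemma coeff_low_part_fun:
  assumes "matroid M" "loopless M" "0 < rk M"
  shows "coeff (low_part M) i = (if 2 * i < rk M
    then coeff (Y_proper low_part M) (rk M - i) - coeff (Y_proper low_part M) i else 0)"
proof -
  have "finite {i. 2 * i < rk M}" by (rule finite_subset[of _ "{..rk M}"]) auto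
  then show ?thesis
    unfolding low_part_eq[OF assms] by (simp add: coeff_sum sum.delta)
qed

lemma degree_low_part:
  assumes "matroid M" "loopless M" "0 < rk M"
  shows "2 * degree (low_part M) < rk M"
proof (cases "degree (low_part M) = 0")
  case False
  then have "coeff (low_part M) (degree (low_part M)) \<noteq> 0" by (metis degree_0 leading_coeff_0_iff)
  then show ?thesis using coeff_low_part_fun[OF assms, of "degree (low_part M)"] by (metis)
qed (use assms in simp)

lemma is_low_part_low_part:
  assumes "matroid M" "loopless M"
  shows "is_low_part low_part M"
proof (cases "rk M = 0")
  case True
  interpret matroid M by fact
  \<comment> \<open>Without loops any point would give positive rank, so rank 0 leaves only the
    empty ground set.\<close>
  have "ground M = {}"
  proof (rule ccontr)
    assume "ground M \<noteq> {}"
    then obtain x where "x \<in> ground M" by blast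
    then have "{x} \<in> indep M" using assms by (auto simp: loopless_def loops_def)
    then show False using card_le_rank[of "{x}" "ground M"] True \<open>x \<in> ground M\<close> by (simp add: rk_def)
  qed
  then have fl: "flats M = {ground M}" using flats_subset_ground ground_in_flats by fastforce
  have one: "low_part M = 1" using True assms by (simp add: low_part.simps)
  have "Y_sum low_part M = 1"
    using Y_sum_eq[of low_part] one True by (simp add: Y_proper_def fl)
  moreover have "reversal 0 1 = (1 :: int poly)" by (rule poly_eqI) (auto simp: coeff_reversal)
  ultimately show ?thesis using True one by (simp add: is_low_part_def palindromic_def)
next
  case False
  interpret matroid M by fact
  let ?V = "Y_proper low_part M"
  have pos: "0 < rk M" using False by simp
  have coeff: "coeff (low_part M) i = (if 2 * i < rk M then coeff ?V (rk M - i) - coeff ?V i else 0)"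
    for i using coeff_low_part_fun[OF assms pos] .
  \<comment> \<open>\<open>reversal\<close> discards coefficients above \<open>rk M\<close>, so
    these must vanish: \<open>low_part\<close> of the restriction to \<open>F\<close> has degree at
    most \<open>rank M F\<close>.\<close>
  have high: "coeff ?V i = 0" if "rk M < i" for i
  proof -
    have "coeff (low_part (restrict M F) * monom c (rk M - rank M F)) i = 0"
      if F: "F \<in> flats M - {ground M}" for F c
    proof -
      have le: "rank M F \<le> rk M" using F rank_le_rk flats_subset_ground by blast
      have "degree (low_part (restrict M F)) \<le> rank M F"
      proof (cases "rank M F = 0")
        case True
        then show ?thesis using low_part.simps[of "restrict M F"] by simp
      next
        case False
        then show ?thesis
          using degree_low_part[of "restrict M F"] proper_flat_minor[of M F] assms F by auto
      qed
      then show ?thesis using \<open>rk M < i\<close> le by (auto simp: coeff_mult_monom intro!: coeff_eq_0)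
    qed
    then show ?thesis unfolding Y_proper_eq coeff_sum by (intro sum.neutral) blast
  qed
  have "reversal (rk M) (?V + low_part M) = ?V + low_part M"
  proof (rule poly_eqI)
    show "poly.coeff (reversal (rk M) (?V + low_part M)) i = poly.coeff (?V + low_part M) i" for i
      \<comment> \<open>The middle coefficient mirrors itself; for every other
        \<open>i \<le> rk M\<close>, exactly one of \<open>i\<close> and \<open>rk M - i\<close>
        lies below the middle and receives the correction.\<close>
      by (cases "rk M - i = i") (auto simp: coeff_reversal coeff high)
  qed
  then have "palindromic (rk M) (Y_sum low_part M)"
    by (metis Y_sum_eq palindromic_def palindromic_signed)
  then show ?thesis
    using degree_low_part[OF assms pos] pos by (simp add: is_low_part_def)
qed

lemma is_inverse_KL_inverse_KL: "is_inverse_KL inverse_KL"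
proof -
  have "is_inverse_KL low_part"
    unfolding is_inverse_KL_iff by (metis is_low_part_low_part low_part.simps)
  \<comment> \<open>Two solutions agree on loopless matroids by \<open>low_part_unique\<close> and
    are 0 elsewhere, so the definite description is justified.\<close>
  moreover have "Q = Q'" if "is_inverse_KL Q" "is_inverse_KL Q'" for Q Q' :: "'a indep_system \<Rightarrow> int poly"
    using low_part_unique[of Q Q'] that unfolding is_inverse_KL_iff by (metis ext)
  ultimately show ?thesis unfolding inverse_KL_def by (metis theI)
qed

lemma is_low_part_inverse_KL: "matroid M \<Longrightarrow> loopless M \<Longrightarrow> is_low_part inverse_KL M"
  using is_inverse_KL_inverse_KL unfolding is_inverse_KL_iff by blast

section \<open>Alternating sums over intervals of subsets\<close>

text \<open>The map \<open>D \<mapsto> A \<union> D\<close> identifies the subsets of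
  \<open>B - A\<close> with the interval; these are grouped by size.\<close>

lemma sum_interval_card:
  fixes g :: "nat \<Rightarrow> int"
  assumes "finite B" "A \<subseteq> B"
  shows "(\<Sum>C \<in> {C. A \<subseteq> C \<and> C \<subseteq> B}. g (card C)) =
    (\<Sum>i\<le>card B - card A. int (card B - card A choose i) * g (card A + i))"
proof -
  have finA: "finite A" using assms finite_subset by blast
  have inj: "inj_on (\<lambda>D. A \<union> D) (Pow (B - A))" by (rule inj_onI) blast
  have cBA: "card (B - A) = card B - card A" using assms finA by (simp add: card_Diff_subset)
  have img: "{C. A \<subseteq> C \<and> C \<subseteq> B} = (\<lambda>D. A \<union> D) ` Pow (B - A)"
  proof (intro equalityI subsetI)
    fix C assume "C \<in> {C. A \<subseteq> C \<and> C \<subseteq> B}"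
    then have "C = A \<union> (C - A)" "C - A \<in> Pow (B - A)" by auto
    then show "C \<in> (\<lambda>D. A \<union> D) ` Pow (B - A)" by blast
  qed (use assms in auto)
  have cU: "card (A \<union> D) = card A + card D" if "D \<in> Pow (B - A)" for D
    using that assms finA by (intro card_Un_disjoint) (auto intro: finite_subset)
  have "(\<Sum>C \<in> {C. A \<subseteq> C \<and> C \<subseteq> B}. g (card C)) = (\<Sum>D \<in> Pow (B - A). g (card A + card D))"
    unfolding img by (simp add: sum.reindex[OF inj] cU)
  also have "\<dots> = (\<Sum>i\<le>card (B - A). \<Sum>D \<in> {D \<in> Pow (B - A). card D = i}. g (card A + card D))"
    using assms by (intro sum.group[symmetric]) (auto intro!: card_mono)
  also have "\<dots> = (\<Sum>i\<le>card (B - A). int (card {D. D \<subseteq> B - A \<and> card D = i}) * g (card A + i))"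
    by simp
  also have "\<dots> = (\<Sum>i\<le>card B - card A. int (card B - card A choose i) * g (card A + i))"
    using assms by (simp add: n_subsets cBA)
  finally show ?thesis .
qed

lemma sum_interval_card_eq:
  fixes c :: int
  assumes "finite B" "A \<subseteq> B" "card A \<le> j"
  shows "(\<Sum>C \<in> {C. A \<subseteq> C \<and> C \<subseteq> B}. if card C = j then c else 0) =
    int (card B - card A choose (j - card A)) * c"
proof -
  have "(\<Sum>C \<in> {C. A \<subseteq> C \<and> C \<subseteq> B}. if card C = j then c else 0) =
      (\<Sum>i\<le>card B - card A. if i = j - card A then int (card B - card A choose i) * c else 0)"
    unfolding sum_interval_card[OF assms(1,2), of "\<lambda>m. if m = j then c else 0"]
    using assms(3) by (intro sum.cong) auto
  then show ?thesis by (simp add: sum.delta binomial_eq_0)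
qed

text \<open>Pascal's rule makes the truncated alternating row sum telescope.\<close>

lemma partial_alternating_sum:
  "(\<Sum>i\<le>m. int (Suc b choose i) * (-1) ^ i) = (-1) ^ m * int (b choose m)"
  by (induction m) (simp_all add: algebra_simps)

text \<open>The Moebius sum over a Boolean interval cut off at size \<open>k\<close>. The cut-offs
  \<open>card B\<close>, \<open>k - 1\<close> and \<open>k\<close> serve Boolean intervals,
  dependent hyperplanes and the ground set in turn.\<close>

lemma alternating_sum_below:
  assumes "finite B" "A \<subset> B" "card A < k"
  shows "(\<Sum>C \<in> {C. A \<subseteq> C \<and> C \<subseteq> B \<and> card C < k}. (-1) ^ (card C - card A)) =
    (-1) ^ (k - 1 - card A) * int (card B - card A - 1 choose (k - 1 - card A))"
proof -
  let ?a = "card B - card A"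
  have pos: "?a = Suc (?a - 1)" using psubset_card_mono[OF assms(1,2)] by simp
  have fin: "finite {C. A \<subseteq> C \<and> C \<subseteq> B}" using assms by (auto intro: finite_subset[of _ "Pow B"])
  have "(\<Sum>C \<in> {C. A \<subseteq> C \<and> C \<subseteq> B \<and> card C < k}. (-1) ^ (card C - card A)) =
      (\<Sum>C \<in> {C. A \<subseteq> C \<and> C \<subseteq> B}. if card C < k then (-1) ^ (card C - card A) else (0::int))"
    using fin by (intro sum.mono_neutral_cong_left) auto
  also have "\<dots> = (\<Sum>i\<le>?a. int (?a choose i) * (if card A + i < k then (-1) ^ i else 0))"
    using sum_interval_card[OF assms(1) psubset_imp_subset[OF assms(2)],
        of "\<lambda>m. if m < k then (-1) ^ (m - card A) else 0"] by (simp cong: if_cong)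
  also have "\<dots> = (\<Sum>i\<le>k - 1 - card A. int (?a choose i) * (-1) ^ i)"
    by (rule sum.mono_neutral_cong) (use assms in \<open>auto simp: binomial_eq_0\<close>)
  also have "\<dots> = (-1) ^ (k - 1 - card A) * int (?a - 1 choose (k - 1 - card A))"
    using partial_alternating_sum[of "?a - 1" "k - 1 - card A"] pos by simp
  finally show ?thesis .
qed

lemma moebius_boolean:
  assumes "finite B" "A \<subseteq> B" "\<And>C. A \<subseteq> C \<Longrightarrow> C \<subseteq> B \<Longrightarrow> C \<in> L"
  shows "moebius L A B = (-1) ^ (card B - card A)"
  using assms
proof (induction "card B" arbitrary: B rule: less_induct)
  case less
  show ?case
  proof (cases "A = B")
    case False
    then have AB: "A \<subset> B" using less.prems by blast
    have lt: "card A < card B" using psubset_card_mono less.prems AB by blast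
    have below: "{C. A \<subseteq> C \<and> C \<subseteq> B \<and> card C < card B} = {C \<in> L. A \<subseteq> C \<and> C \<subset> B}"
      using less.prems psubset_card_mono[of B] by auto
    have "moebius L A C = (-1) ^ (card C - card A)" if "C \<in> {C \<in> L. A \<subseteq> C \<and> C \<subset> B}" for C
      using that less.prems psubset_card_mono[of B C] finite_subset[of C B]
      by (intro less.hyps) auto
    then have "moebius L A B = - (\<Sum>C \<in> {C \<in> L. A \<subseteq> C \<and> C \<subset> B}. (-1) ^ (card C - card A))"
      using AB less.prems by (simp add: moebius.simps[of L A B])
    \<comment> \<open>The cut-off \<open>card B\<close> leaves out only \<open>B\<close>, and the
      binomial coefficient is a diagonal one, hence 1.\<close>
    also have "\<dots> = - ((-1) ^ (card B - 1 - card A))"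
      unfolding below[symmetric] alternating_sum_below[OF less.prems(1) AB lt]
      by (simp add: diff_commute)
    also have "\<dots> = (-1) ^ (card B - card A)"
    proof -
      have "card B - card A = Suc (card B - 1 - card A)" using lt by simp
      then show ?thesis by simp
    qed
    finally show ?thesis .
  qed simp
qed

section \<open>Flats of sparse paving matroids\<close>

text \<open>The two conditions are the form in which sparse pavingness is used: no circuit has fewer than
  \<open>k\<close> elements, and every set with more than \<open>k\<close> elements spans.\<close>

locale sparse_paving_matroid = matroid +
  fixes k :: nat
  assumes rk_eq: "rk M = k"
    and rank_pos: "0 < k"
    and small_indep: "X \<subseteq> ground M \<Longrightarrow> card X < k \<Longrightarrow> X \<in> indep M"
    and large_spans: "X \<subseteq> ground M \<Longrightarrow> k < card X \<Longrightarrow> rank M X = k"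
begin

text \<open>These are exactly the circuit-hyperplanes, by \<open>circuit_hyperplane_iff\<close>;
  size and dependence are easier to count with.\<close>

definition dependent_hyperplanes :: "'a set set" where
  "dependent_hyperplanes = {H. H \<subseteq> ground M \<and> card H = k \<and> H \<notin> indep M}"

text \<open>The proper flats with fewer than \<open>k\<close> elements: the last condition only
  removes the \<open>(k - 1)\<close>-sets inside a dependent hyperplane, whose closure is that
  hyperplane.\<close>

definition low_flats :: "'a set set" where
  "low_flats = {F. F \<subseteq> ground M \<and> card F < k \<and> (\<forall>H \<in> dependent_hyperplanes. F \<subseteq> H \<longrightarrow> card F + 1 < k)}"

definition hyperplanes_above :: "'a set \<Rightarrow> 'a set set" where
  "hyperplanes_above F = {H \<in> dependent_hyperplanes. F \<subseteq> H}"

lemma finite_within: "X \<subseteq> ground M \<Longrightarrow> finite X"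
  using finite_ground finite_subset by blast

lemma finite_dependent_hyperplanes: "finite dependent_hyperplanes"
  by (rule finite_subset[of _ "Pow (ground M)"]) (auto simp: dependent_hyperplanes_def finite_ground)

lemma rank_small: "X \<subseteq> ground M \<Longrightarrow> card X < k \<Longrightarrow> rank M X = card X"
  using small_indep rank_indep by blast

lemma rank_dependent_hyperplane:
  assumes "H \<in> dependent_hyperplanes"
  shows "rank M H = k - 1"
proof -
  have H: "H \<subseteq> ground M" "card H = k" "H \<notin> indep M" "finite H"
    using assms finite_within by (auto simp: dependent_hyperplanes_def)
  then have "rank M H \<le> k" "rank M H \<noteq> k" using rank_le_card indep_iff_rank by auto
  moreover obtain x where "x \<in> H" using H rank_pos by fastforce
  then have "card (H - {x}) = k - 1" "H - {x} \<subseteq> ground M" using H by auto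
  then have "k - 1 \<le> rank M H" using small_indep card_le_rank[of "H - {x}" H] rank_pos by auto
  ultimately show ?thesis by simp
qed

lemma k_le_card: "k \<le> card (ground M)"
  using rank_le_card[OF finite_ground] rk_eq by (simp add: rk_def)

lemma ground_not_hyperplane: "ground M \<notin> dependent_hyperplanes"
  using rank_dependent_hyperplane[of "ground M"] rk_eq rank_pos by (auto simp: rk_def)

lemma low_flats_disjoint: "low_flats \<inter> dependent_hyperplanes = {}"
  by (auto simp: low_flats_def dependent_hyperplanes_def)

lemma ground_not_low: "ground M \<notin> low_flats"
  using k_le_card by (auto simp: low_flats_def)

lemma finite_low_flats: "finite low_flats"
  by (rule finite_subset[of _ "Pow (ground M)"]) (auto simp: low_flats_def finite_ground)

text \<open>A proper flat does not span, so it has at most \<open>k\<close> elements, and with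
  exactly \<open>k\<close> it is dependent. A \<open>(k - 1)\<close>-set inside a dependent
  hyperplane has the same rank and is not closed; the other small sets are closed because adding a
  point keeps them independent.\<close>

lemma proper_flats: "flats M - {ground M} = low_flats \<union> dependent_hyperplanes"
proof (intro equalityI subsetI)
  fix F assume F: "F \<in> flats M - {ground M}"
  then have sub: "F \<subset> ground M" using flats_subset_ground by blast
  have lt: "rank M F < k" using rank_flat_less[of F "ground M"] F sub rk_eq by (auto simp: rk_def)
  have "card F \<le> k" using large_spans[of F] lt sub by force
  show "F \<in> low_flats \<union> dependent_hyperplanes"
  proof (cases "card F = k")
    case True
    then have "F \<in> dependent_hyperplanes"
      using lt sub rank_indep[of F] by (auto simp: dependent_hyperplanes_def)
    then show ?thesis by blast
  next
    case False
    then have cF: "card F < k" using \<open>card F \<le> k\<close> by simp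
    have "card F + 1 < k" if H: "H \<in> dependent_hyperplanes" "F \<subseteq> H" for H
    proof (rule ccontr)
      assume "\<not> card F + 1 < k"
      then have "rank M F = rank M H"
        using rank_small[of F] rank_dependent_hyperplane[OF H(1)] sub cF by auto
      moreover have "F \<subset> H" "H \<subseteq> ground M" using H False by (auto simp: dependent_hyperplanes_def)
      ultimately show False using rank_flat_less[of F H] F by auto
    qed
    then show ?thesis using sub cF by (auto simp: low_flats_def)
  qed
next
  fix F assume F: "F \<in> low_flats \<union> dependent_hyperplanes"
  then have sub: "F \<subseteq> ground M" by (auto simp: low_flats_def dependent_hyperplanes_def)
  have "rank M F < rank M (insert x F)" if x: "x \<in> ground M - F" for x
  proof -
    have c: "card (insert x F) = Suc (card F)" "insert x F \<subseteq> ground M"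
      using x sub finite_within by auto
    show ?thesis
    proof (cases "F \<in> low_flats")
      case True
      have "insert x F \<in> indep M"
      proof (cases "card F + 1 < k")
        case False
        then have "card (insert x F) = k" using True c by (auto simp: low_flats_def)
        moreover have "insert x F \<notin> dependent_hyperplanes"
          using True False by (auto simp: low_flats_def)
        ultimately show ?thesis using c by (auto simp: dependent_hyperplanes_def)
      qed (use c small_indep in auto)
      then show ?thesis using rank_small[of F] rank_indep c sub True by (auto simp: low_flats_def)
    next
      case False
      then have H: "F \<in> dependent_hyperplanes" using F by blast
      then have "rank M (insert x F) = k"
        using c by (intro large_spans) (auto simp: dependent_hyperplanes_def)
      then show ?thesis using rank_dependent_hyperplane[OF H] rank_pos by simp
    qed
  qed
  then show "F \<in> flats M - {ground M}"
    using sub F ground_not_hyperplane ground_not_low by (auto simp: flats_def flat_def)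
qed

lemma flats_eq: "flats M = insert (ground M) (low_flats \<union> dependent_hyperplanes)"
  using proper_flats ground_in_flats by blast

text \<open>The point \<open>y\<close> of \<open>H'\<close> outside \<open>F\<close> does not raise
  the rank of \<open>F\<close>, hence not that of \<open>H\<close>; but if \<open>y\<close> were
  outside \<open>H\<close>, then \<open>insert y H\<close> would have \<open>k + 1\<close> elements
  and span.\<close>

lemma dependent_hyperplanes_meet_low:
  assumes "H \<in> dependent_hyperplanes" "H' \<in> dependent_hyperplanes" "F \<subseteq> H" "F \<subseteq> H'" "card F + 1 = k"
  shows "H = H'"
proof (rule ccontr)
  assume neq: "H \<noteq> H'"
  have sub: "H \<subseteq> ground M" "H' \<subseteq> ground M" "card H = k" "card H' = k" "finite H" "finite H'"
    using assms finite_within by (auto simp: dependent_hyperplanes_def)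
  have "card (H' - F) = 1" using sub assms card_Diff_subset[of F H'] finite_subset[of F H'] by auto
  then obtain y where y: "H' - F = {y}" by (auto simp: card_1_singleton_iff)
  then have H': "H' = insert y F" using assms by blast
  have yH: "y \<notin> H"
  proof
    assume "y \<in> H"
    then have "H' = H" using H' assms sub by (intro card_subset_eq) auto
    then show False using neq by simp
  qed
  have "rank M (insert y F) = rank M F"
    using rank_dependent_hyperplane[OF assms(2)] rank_small[of F] H' assms sub by auto
  then have "rank M (insert y H) = rank M H" using rank_insert_eq_mono assms by blast
  moreover have "rank M (insert y H) = k"
    using sub yH y by (intro large_spans) auto
  ultimately show False using rank_dependent_hyperplane[OF assms(1)] rank_pos by simp
qed

text \<open>Turns the failure of a \<open>(k - 1)\<close>-set to be a flat into a count of
  hyperplanes, so that corrections can be summed hyperplane by hyperplane.\<close>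

lemma card_hyperplanes_above:
  assumes "F \<subseteq> ground M" "card F + 1 = k"
  shows "card (hyperplanes_above F) = (if F \<in> low_flats then 0 else 1)"
proof (cases "F \<in> low_flats")
  case True
  then have "hyperplanes_above F = {}" using assms by (auto simp: hyperplanes_above_def low_flats_def)
  then show ?thesis using True by simp
next
  case False
  then obtain H where H: "H \<in> dependent_hyperplanes" "F \<subseteq> H" using assms by (auto simp: low_flats_def)
  then have "hyperplanes_above F = {H}"
    unfolding hyperplanes_above_def using dependent_hyperplanes_meet_low[OF _ H(1) _ H(2) assms(2)] by blast
  then show ?thesis using False by simp
qed

lemma moebius_low_flats:
  assumes "F \<in> low_flats" "G \<in> low_flats" "F \<subseteq> G"
  shows "moebius (flats M) F G = (-1) ^ (card G - card F)"
proof (rule moebius_boolean)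
  have G: "G \<subseteq> ground M" "card G < k" using assms by (auto simp: low_flats_def)
  then show "finite G" by (intro finite_within)
  show "C \<in> flats M" if "F \<subseteq> C" "C \<subseteq> G" for C
  proof (cases "C = G")
    case False
    then have "card C < card G" using that \<open>finite G\<close> by (intro psubset_card_mono) auto
    then have "C \<in> low_flats" using that G by (auto simp: low_flats_def)
    then show ?thesis using flats_eq by blast
  qed (use assms flats_eq in auto)
qed fact

text \<open>The \<open>(k - 1)\<close>-subsets of \<open>H\<close> are not closed, so the interval
  strictly below \<open>H\<close> is Boolean cut off at size \<open>k - 1\<close>. The binomial
  coefficient is \<open>m choose (m - 1)\<close> with \<open>m = k - 1 - card F\<close>.\<close>

lemma moebius_low_hyperplane:
  assumes F: "F \<in> low_flats" and H: "H \<in> dependent_hyperplanes" and "F \<subseteq> H"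
  shows "moebius (flats M) F H = (-1) ^ (k - 1 - card F) * (int k - 1 - int (card F))"
proof -
  have H': "H \<subseteq> ground M" "card H = k" "finite H"
    using H finite_within by (auto simp: dependent_hyperplanes_def)
  have cF: "card F + 1 < k" using assms by (auto simp: low_flats_def)
  have FH: "F \<subset> H" using assms cF H' by auto
  have below: "{C \<in> flats M. F \<subseteq> C \<and> C \<subset> H} = {C. F \<subseteq> C \<and> C \<subseteq> H \<and> card C < k - 1}"
  proof (intro equalityI subsetI)
    fix C assume C: "C \<in> {C \<in> flats M. F \<subseteq> C \<and> C \<subset> H}"
    then have "card C < k" using psubset_card_mono[of H C] H' by auto
    then have "C \<in> low_flats"
      using C H' flats_eq k_le_card by (auto simp: dependent_hyperplanes_def)
    then show "C \<in> {C. F \<subseteq> C \<and> C \<subseteq> H \<and> card C < k - 1}"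
      using C H by (auto simp: low_flats_def)
  next
    fix C assume C: "C \<in> {C. F \<subseteq> C \<and> C \<subseteq> H \<and> card C < k - 1}"
    then have "C \<in> low_flats" using H' by (auto simp: low_flats_def)
    then show "C \<in> {C \<in> flats M. F \<subseteq> C \<and> C \<subset> H}" using C H' flats_eq by auto
  qed
  have "moebius (flats M) F H = - (\<Sum>C \<in> {C \<in> flats M. F \<subseteq> C \<and> C \<subset> H}. moebius (flats M) F C)"
    using FH H' by (simp add: moebius.simps[of "flats M" F H] psubset_eq)
  also have "\<dots> = - (\<Sum>C \<in> {C \<in> flats M. F \<subseteq> C \<and> C \<subset> H}. (-1) ^ (card C - card F))"
  proof -
    have "moebius (flats M) F C = (-1) ^ (card C - card F)" if "C \<in> {C \<in> flats M. F \<subseteq> C \<and> C \<subset> H}" for C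
    proof -
      have "card C < k - 1" "C \<subseteq> ground M" "F \<subseteq> C" using that H' unfolding below by auto
      then have "C \<in> low_flats" by (auto simp: low_flats_def)
      then show ?thesis using moebius_low_flats[OF F] \<open>F \<subseteq> C\<close> by blast
    qed
    then show ?thesis by (intro arg_cong[where f = uminus] sum.cong) auto
  qed
  also have "\<dots> = - ((-1) ^ (k - 1 - 1 - card F) * int (k - card F - 1 choose (k - 1 - 1 - card F)))"
    unfolding below using alternating_sum_below[of H F "k - 1"] H' FH cF by simp
  also have "\<dots> = (-1) ^ (k - 1 - card F) * (int k - 1 - int (card F))"
  proof -
    obtain a where a: "k = card F + Suc (Suc a)" using cF by (metis add.commute add_Suc_right less_imp_Suc_add plus_1_eq_Suc)
    then show ?thesis by simp
  qed
  finally show ?thesis .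
qed

text \<open>Both kinds of circuit-hyperplane contributions (the hyperplane \<open>H\<close> itself, and the sets of size
  \<open>k - 1\<close> that it prevents from being flats) together amount to one unit per \<open>H\<close> above \<open>F\<close>.\<close>

lemma moebius_low_top:
  assumes F: "F \<in> low_flats"
  shows "(-1) ^ (k - card F) * moebius (flats M) F (ground M) =
    int (card (ground M) - card F - 1 choose (k - 1 - card F)) - int (card (hyperplanes_above F))"
proof -
  let ?E = "ground M" and ?j = "card F" and ?h = "\<lambda>G. int (card (hyperplanes_above G))"
  let ?S = "{G. F \<subseteq> G \<and> G \<subseteq> ground M \<and> card G < k}"
  let ?s = "\<lambda>G. (-1) ^ (card G - card F) :: int"
  have F': "F \<subseteq> ?E" "?j < k" using F by (auto simp: low_flats_def)
  have FE: "F \<subset> ?E" using F' ground_not_low F by auto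
  have finS: "finite ?S" using finite_ground by (auto intro: finite_subset[of _ "Pow ?E"])
  have finH: "finite (hyperplanes_above G)" for G
    using finite_dependent_hyperplanes by (simp add: hyperplanes_above_def)
  have below: "{C \<in> flats M. F \<subseteq> C \<and> C \<subset> ?E} = (?S \<inter> low_flats) \<union> hyperplanes_above F"
    using flats_eq ground_not_low ground_not_hyperplane F'
    by (auto simp: low_flats_def hyperplanes_above_def dependent_hyperplanes_def)
  have "- moebius (flats M) F ?E = (\<Sum>C \<in> {C \<in> flats M. F \<subseteq> C \<and> C \<subset> ?E}. moebius (flats M) F C)"
    using FE finite_ground by (simp add: moebius.simps[of "flats M" F ?E] psubset_eq)
  also have "\<dots> = (\<Sum>C \<in> ?S \<inter> low_flats. moebius (flats M) F C) + (\<Sum>H \<in> hyperplanes_above F. moebius (flats M) F H)"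
    unfolding below using finS finH low_flats_disjoint
    by (intro sum.union_disjoint) (auto simp: hyperplanes_above_def)
  also have "(\<Sum>C \<in> ?S \<inter> low_flats. moebius (flats M) F C) = (\<Sum>C \<in> ?S \<inter> low_flats. ?s C)"
    using moebius_low_flats[OF F] by (intro sum.cong) auto
  also have "(\<Sum>C \<in> ?S \<inter> low_flats. ?s C) = (\<Sum>G \<in> ?S. if G \<in> low_flats then ?s G else 0)"
    using finS by (rule sum.inter_restrict)
  \<comment> \<open>Sum over all small sets above \<open>F\<close> and subtract the non-flats of
    size \<open>k - 1\<close>, each counted through the unique dependent hyperplane containing
    it.\<close>
  also have "\<dots> = (\<Sum>G \<in> ?S. ?s G - (\<Sum>H \<in> {H \<in> dependent_hyperplanes. G \<subseteq> H}.
      if card G = k - 1 then (-1) ^ (k - 1 - ?j) else 0))"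
  proof (intro sum.cong refl)
    fix G assume G: "G \<in> ?S"
    show "(if G \<in> low_flats then ?s G else 0) = ?s G - (\<Sum>H \<in> {H \<in> dependent_hyperplanes. G \<subseteq> H}.
      if card G = k - 1 then (-1) ^ (k - 1 - ?j) else 0)"
    proof (cases "card G = k - 1")
      case True
      then have "card (hyperplanes_above G) = (if G \<in> low_flats then 0 else 1)"
        using G rank_pos by (intro card_hyperplanes_above) auto
      then show ?thesis using True by (simp add: hyperplanes_above_def)
    next
      case False
      then have "G \<in> low_flats" using G by (auto simp: low_flats_def)
      then show ?thesis using False by simp
    qed
  qed
  also have "\<dots> = (\<Sum>G \<in> ?S. ?s G) - (\<Sum>G \<in> ?S. \<Sum>H \<in> {H \<in> dependent_hyperplanes. G \<subseteq> H}.
      if card G = k - 1 then (-1) ^ (k - 1 - ?j) else 0)"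
    by (rule sum_subtractf)
  also have "(\<Sum>G \<in> ?S. \<Sum>H \<in> {H \<in> dependent_hyperplanes. G \<subseteq> H}.
      if card G = k - 1 then (-1) ^ (k - 1 - ?j) else 0) =
    (\<Sum>H \<in> dependent_hyperplanes. \<Sum>G \<in> {G \<in> ?S. G \<subseteq> H}. if card G = k - 1 then (-1) ^ (k - 1 - ?j) else (0::int))"
    by (rule sum.swap_restrict[OF finS finite_dependent_hyperplanes])
  \<comment> \<open>A hyperplane above \<open>F\<close> contains \<open>k - ?j\<close> sets of size
    \<open>k - 1\<close> above \<open>F\<close>; any other contains none.\<close>
  also have "\<dots> = (\<Sum>H \<in> hyperplanes_above F. int (k - ?j) * (-1) ^ (k - 1 - ?j))"
    unfolding hyperplanes_above_def
  proof (rule sum.mono_neutral_cong_right[OF finite_dependent_hyperplanes])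
    show "\<forall>H \<in> dependent_hyperplanes - {H \<in> dependent_hyperplanes. F \<subseteq> H}.
        (\<Sum>G \<in> {G \<in> ?S. G \<subseteq> H}. if card G = k - 1 then (-1) ^ (k - 1 - ?j) else (0::int)) = 0"
      by (auto intro!: sum.neutral)
    fix H assume H: "H \<in> {H \<in> dependent_hyperplanes. F \<subseteq> H}"
    then have H': "H \<subseteq> ?E" "card H = k" "finite H" "F \<subseteq> H"
      using finite_within by (auto simp: dependent_hyperplanes_def)
    have "(\<Sum>G \<in> {G \<in> ?S. G \<subseteq> H}. if card G = k - 1 then (-1) ^ (k - 1 - ?j) else 0) =
        (\<Sum>G \<in> {G. F \<subseteq> G \<and> G \<subseteq> H}. if card G = k - 1 then (-1) ^ (k - 1 - ?j) else (0::int))"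
      using H' rank_pos by (intro sum.mono_neutral_left) (auto intro: finite_subset[of _ "Pow H"])
    also have "\<dots> = int (k - ?j choose (k - 1 - ?j)) * (-1) ^ (k - 1 - ?j)"
      using sum_interval_card_eq[of H F "k - 1"] H' F' by simp
    also have "k - ?j choose (k - 1 - ?j) = k - ?j"
      using binomial_symmetric[of 1 "k - ?j"] F' by (simp add: diff_commute)
    finally show "(\<Sum>G \<in> {G \<in> ?S. G \<subseteq> H}. if card G = k - 1 then (-1) ^ (k - 1 - ?j) else 0) =
        int (k - ?j) * (-1) ^ (k - 1 - ?j)" .
  qed simp
  also have "(\<Sum>G \<in> ?S. ?s G) = (-1) ^ (k - 1 - ?j) * int (card ?E - ?j - 1 choose (k - 1 - ?j))"
    using alternating_sum_below[OF finite_ground FE] F' by simp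
  also have "(\<Sum>H \<in> hyperplanes_above F. moebius (flats M) F H) =
      (\<Sum>H \<in> hyperplanes_above F. (-1) ^ (k - 1 - ?j) * (int k - 1 - int ?j))"
    using moebius_low_hyperplane[OF F] by (intro sum.cong) (auto simp: hyperplanes_above_def)
  \<comment> \<open>Up to the common sign, each \<open>H\<close> contributes
    \<open>k - 1 - ?j\<close> as a flat and removes \<open>k - ?j\<close> through the lost sets,
    which leaves -1.\<close>
  finally have "- moebius (flats M) F ?E = (-1) ^ (k - 1 - ?j) *
      (int (card ?E - ?j - 1 choose (k - 1 - ?j)) - ?h F)"
    using F' by (simp add: of_nat_diff algebra_simps)
  moreover have "(-1) ^ (k - ?j) = - ((-1) ^ (k - 1 - ?j) :: int)"
  proof -
    have "k - ?j = Suc (k - 1 - ?j)" using F' by simp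
    then show ?thesis by simp
  qed
  moreover have "(-1) ^ (k - 1 - ?j) * ((-1) ^ (k - 1 - ?j) * x) = x" for x :: int
    by (simp add: mult.assoc[symmetric] power_add[symmetric])
  ultimately show ?thesis by (metis minus_mult_commute)
qed

lemma moebius_hyperplane_top:
  assumes "H \<in> dependent_hyperplanes"
  shows "moebius (flats M) H (ground M) = -1"
proof -
  have H: "H \<subseteq> ground M" "card H = k" using assms by (auto simp: dependent_hyperplanes_def)
  have "C = H" if C: "C \<in> flats M" "H \<subseteq> C" "C \<subset> ground M" for C
  proof -
    have "C \<in> low_flats \<union> dependent_hyperplanes" using C flats_eq by auto
    then have "card C \<le> k" "C \<subseteq> ground M" by (auto simp: low_flats_def dependent_hyperplanes_def)
    then show ?thesis using C H card_seteq[of C H] finite_within by auto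
  qed
  moreover have "H \<subset> ground M" using H assms ground_not_hyperplane by auto
  ultimately have "{C \<in> flats M. H \<subseteq> C \<and> C \<subset> ground M} = {H}" using assms flats_eq by auto
  then show ?thesis
    using \<open>H \<subset> ground M\<close> finite_ground by (simp add: moebius.simps[of "flats M" H "ground M"] psubset_eq)
qed

end

section \<open>The inverse Z-polynomial of a sparse paving matroid\<close>

context sparse_paving_matroid
begin

text \<open>\<open>Q = 1\<close> on low flats is a hypothesis so that the formula also serves the
  induction that proves it for Boolean matroids. A dependent hyperplane has corank 1 and Moebius
  value -1 to the top, whence the factor \<open>monom 1 1\<close>.\<close>

lemma Y_proper_sparse_paving:
  assumes "\<forall>F \<in> low_flats. Q (restrict M F) = 1"
  shows "Y_proper Q M = (\<Sum>F \<in> low_flats. monom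
      (int (card (ground M) - card F - 1 choose (k - 1 - card F)) - int (card (hyperplanes_above F)))
      (k - card F)) + (\<Sum>H \<in> dependent_hyperplanes. Q (restrict M H) * monom 1 1)"
proof -
  have "Y_proper Q M = (\<Sum>F \<in> low_flats. Q (restrict M F) *
      monom ((-1) ^ (rk M - rank M F) * moebius (flats M) F (ground M)) (rk M - rank M F)) +
    (\<Sum>H \<in> dependent_hyperplanes. Q (restrict M H) *
      monom ((-1) ^ (rk M - rank M H) * moebius (flats M) H (ground M)) (rk M - rank M H))"
    unfolding Y_proper_eq proper_flats
    using finite_low_flats finite_dependent_hyperplanes low_flats_disjoint by (rule sum.union_disjoint)
  also have "(\<Sum>F \<in> low_flats. Q (restrict M F) *
      monom ((-1) ^ (rk M - rank M F) * moebius (flats M) F (ground M)) (rk M - rank M F)) =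
    (\<Sum>F \<in> low_flats. monom
      (int (card (ground M) - card F - 1 choose (k - 1 - card F)) - int (card (hyperplanes_above F)))
      (k - card F))"
  proof (intro sum.cong refl)
    fix F assume F: "F \<in> low_flats"
    then have "rank M F = card F" by (intro rank_small) (auto simp: low_flats_def)
    then show "Q (restrict M F) *
        monom ((-1) ^ (rk M - rank M F) * moebius (flats M) F (ground M)) (rk M - rank M F) =
      monom (int (card (ground M) - card F - 1 choose (k - 1 - card F)) -
        int (card (hyperplanes_above F))) (k - card F)"
      using assms F moebius_low_top[OF F] rk_eq by simp
  qed
  also have "(\<Sum>H \<in> dependent_hyperplanes. Q (restrict M H) *
      monom ((-1) ^ (rk M - rank M H) * moebius (flats M) H (ground M)) (rk M - rank M H)) =
    (\<Sum>H \<in> dependent_hyperplanes. Q (restrict M H) * monom 1 1)"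
  proof (intro sum.cong refl)
    fix H assume H: "H \<in> dependent_hyperplanes"
    have "rk M - rank M H = 1" using rank_dependent_hyperplane[OF H] rk_eq rank_pos by simp
    then show "Q (restrict M H) *
        monom ((-1) ^ (rk M - rank M H) * moebius (flats M) H (ground M)) (rk M - rank M H) =
        Q (restrict M H) * monom 1 1"
      using moebius_hyperplane_top[OF H] by simp
  qed
  finally show ?thesis .
qed

lemma coeff_0_Y_proper:
  assumes "\<forall>F \<in> low_flats. Q (restrict M F) = 1"
  shows "coeff (Y_proper Q M) 0 = 0"
  unfolding Y_proper_sparse_paving[OF assms] coeff_add coeff_sum coeff_mult_monom coeff_monom
  by (auto intro!: sum.neutral simp: low_flats_def)

text \<open>Apart from the hyperplane terms, only sets of size \<open>k - i\<close> contribute, and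
  the sum may be extended from low flats to all such sets. Each dependent hyperplane contains
  \<open>k choose i\<close> of them.\<close>

lemma coeff_Y_proper:
  assumes Q: "\<forall>F \<in> low_flats. Q (restrict M F) = 1" and i: "0 < i" "i \<le> k"
  shows "coeff (Y_proper Q M) i =
    int (card (ground M) choose (k - i)) * int (card (ground M) - (k - i) - 1 choose (i - 1))
    - int (card dependent_hyperplanes) * int (k choose i)
    + (\<Sum>H \<in> dependent_hyperplanes. coeff (Q (restrict M H)) (i - 1))"
proof -
  let ?n = "card (ground M)" and ?S = "{F. {} \<subseteq> F \<and> F \<subseteq> ground M}"
  let ?c = "int (?n - (k - i) - 1 choose (i - 1))"
  have finS: "finite ?S" using finite_ground by simp
  have "(\<Sum>F \<in> low_flats. coeff (monom (int (?n - card F - 1 choose (k - 1 - card F)) -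
        int (card (hyperplanes_above F))) (k - card F)) i) =
      (\<Sum>F \<in> ?S. (if card F = k - i then ?c else 0) -
        (\<Sum>H \<in> {H \<in> dependent_hyperplanes. F \<subseteq> H}. if card F = k - i then 1 else 0))"
  proof (rule sum.mono_neutral_cong_left[OF finS])
    show "low_flats \<subseteq> ?S" by (auto simp: low_flats_def)
    show "\<forall>F \<in> ?S - low_flats. (if card F = k - i then ?c else 0) -
        (\<Sum>H \<in> {H \<in> dependent_hyperplanes. F \<subseteq> H}. if card F = k - i then 1 else 0) = 0"
    proof
      fix F assume F: "F \<in> ?S - low_flats"
      show "(if card F = k - i then ?c else 0) -
        (\<Sum>H \<in> {H \<in> dependent_hyperplanes. F \<subseteq> H}. if card F = k - i then 1 else 0) = 0"
      proof (cases "card F = k - i")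
        case True
        then have "card F + 1 = k" using F i by (auto simp: low_flats_def)
        \<comment> \<open>For \<open>i = 1\<close> the binomial coefficient \<open>?c\<close> is 1
          and cancels the unique hyperplane above \<open>F\<close>.\<close>
        moreover from this have "i = 1" using True i by simp
        ultimately show ?thesis
          using card_hyperplanes_above[of F] F True by (simp add: hyperplanes_above_def)
      qed simp
    qed
    fix F assume "F \<in> low_flats"
    then have "card F < k" by (simp add: low_flats_def)
    then have "k - card F = i \<longleftrightarrow> card F = k - i" using i by auto
    then show "coeff (monom (int (?n - card F - 1 choose (k - 1 - card F)) -
        int (card (hyperplanes_above F))) (k - card F)) i = (if card F = k - i then ?c else 0) -
        (\<Sum>H \<in> {H \<in> dependent_hyperplanes. F \<subseteq> H}. if card F = k - i then 1 else 0)"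
      using i by (auto simp: hyperplanes_above_def diff_commute)
  qed
  also have "\<dots> = (\<Sum>F \<in> ?S. if card F = k - i then ?c else 0) -
      (\<Sum>F \<in> ?S. \<Sum>H \<in> {H \<in> dependent_hyperplanes. F \<subseteq> H}. if card F = k - i then 1 else 0)"
    by (rule sum_subtractf)
  also have "(\<Sum>F \<in> ?S. \<Sum>H \<in> {H \<in> dependent_hyperplanes. F \<subseteq> H}. if card F = k - i then 1 else (0::int)) =
      (\<Sum>H \<in> dependent_hyperplanes. \<Sum>F \<in> {F \<in> ?S. F \<subseteq> H}. if card F = k - i then 1 else 0)"
    by (rule sum.swap_restrict[OF finS finite_dependent_hyperplanes])
  also have "\<dots> = (\<Sum>H \<in> dependent_hyperplanes. int (k choose i))"
  proof (intro sum.cong refl)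
    fix H assume H: "H \<in> dependent_hyperplanes"
    then have H': "H \<subseteq> ground M" "card H = k" "finite H"
      using finite_within by (auto simp: dependent_hyperplanes_def)
    then have "{F \<in> ?S. F \<subseteq> H} = {F. {} \<subseteq> F \<and> F \<subseteq> H}" by auto
    then show "(\<Sum>F \<in> {F \<in> ?S. F \<subseteq> H}. if card F = k - i then 1 else 0) = int (k choose i)"
      using sum_interval_card_eq[of H "{}" "k - i" 1] H' i binomial_symmetric[of i k] by simp
  qed
  also have "(\<Sum>F \<in> ?S. if card F = k - i then ?c else 0) = int (?n choose (k - i)) * ?c"
    using sum_interval_card_eq[OF finite_ground, of "{}" "k - i" ?c] by simp
  finally show ?thesis
    unfolding Y_proper_sparse_paving[OF Q] coeff_add coeff_sum coeff_mult_monom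
    using i by simp
qed

lemma coeff_inverse_KL:
  assumes "loopless M"
  shows "coeff (inverse_KL M) i = (if 2 * i < k
    then coeff (Y_proper inverse_KL M) (k - i) - coeff (Y_proper inverse_KL M) i else 0)"
  using coeff_low_part[OF matroid_axioms is_low_part_inverse_KL[OF matroid_axioms assms], of i]
    rk_eq rank_pos by simp

end

section \<open>Boolean matroids and Catalan numbers\<close>

lemma inverse_KL_rank_0: "matroid M \<Longrightarrow> loopless M \<Longrightarrow> rk M = 0 \<Longrightarrow> inverse_KL M = 1"
  using is_low_part_inverse_KL[of M] by (simp add: is_low_part_def)

text \<open>A nonempty Boolean matroid fits the sparse paving locale with no dependent hyperplanes,
  and its \<open>Y_proper\<close> has binomial coefficients except for the constant term 0. The
  differences in \<open>coeff_inverse_KL\<close> vanish for \<open>i > 0\<close> and give 1 for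
  \<open>i = 0\<close>.\<close>

lemma inverse_KL_boolean:
  assumes "matroid M" "indep M = Pow (ground M)"
  shows "inverse_KL M = 1"
  using assms
proof (induction "card (ground M)" arbitrary: M rule: less_induct)
  case less
  interpret matroid M by fact
  let ?k = "card (ground M)"
  have loopless: "loopless M" using less.prems by (auto simp: loopless_def loops_def)
  have rk: "rk M = ?k" unfolding rk_def using less.prems by (intro rank_indep) simp
  show ?case
  proof (cases "?k = 0")
    case False
    interpret S: sparse_paving_matroid M ?k
    proof
      \<comment> \<open>Vacuous: no subset of the ground set has more than \<open>?k\<close>
        elements.\<close>
      show "rank M X = ?k" if "X \<subseteq> ground M" "?k < card X" for X
        using that card_mono[OF finite_ground, of X] by simp
    qed (use rk False less.prems in auto)
    have none: "S.dependent_hyperplanes = {}"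
      using less.prems by (auto simp: S.dependent_hyperplanes_def)
    have lower: "\<forall>F \<in> S.low_flats. inverse_KL (restrict M F) = 1"
    proof
      fix F assume "F \<in> S.low_flats"
      then have F: "F \<subseteq> ground M" "card F < ?k" by (auto simp: S.low_flats_def)
      then have "indep (restrict M F) = Pow (ground (restrict M F))"
        using less.prems by (auto simp: restrict_def)
      then show "inverse_KL (restrict M F) = 1"
        using F less.hyps[of "restrict M F"] matroid_restrict[of F] by simp
    qed
    have high: "coeff (Y_proper inverse_KL M) i = int (?k choose i)" if "0 < i" "i \<le> ?k" for i
      using S.coeff_Y_proper[OF lower that] that binomial_symmetric[OF that(2)]
      by (simp add: none)
    show ?thesis
    proof (rule poly_eqI)
      fix i
      show "coeff (inverse_KL M) i = coeff 1 i"
        using S.coeff_inverse_KL[OF loopless, of i] S.coeff_0_Y_proper[OF lower]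
          high[of i] high[of "?k - i"] False binomial_symmetric[of i ?k]
        by (cases "i = 0") auto
    qed
  qed (use inverse_KL_rank_0 loopless rk less.prems in auto)
qed

text \<open>The right-hand side is the coefficient difference that arises for the restriction to a
  dependent hyperplane. The ratio of neighbouring binomial coefficients makes it
  \<open>2 * p choose p\<close> after multiplication by \<open>p + 1\<close>, so the division is
  exact.\<close>

lemma of_nat_catalan:
  assumes "0 < p"
  shows "int (catalan p) = int p * int (2 * p choose (p + 1)) - (int p - 1) * int (2 * p choose p)"
proof -
  have "(p + 1) * (2 * p choose (p + 1)) = p * (2 * p choose p)"
    using binomial_absorb_comp[of "2 * p" p] binomial_absorption[of p "2 * p"] assms
    by (simp add: Suc_times_binomial_eq)
  then have "int (p + 1) * int (2 * p choose (p + 1)) = int p * int (2 * p choose p)"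
    by (metis of_nat_mult)
  then have "(int p * int (2 * p choose (p + 1)) - (int p - 1) * int (2 * p choose p)) * int (p + 1) =
      int (2 * p choose p)"
    by (simp add: algebra_simps)
  then have "int (2 * p choose p) div int (p + 1) =
      int p * int (2 * p choose (p + 1)) - (int p - 1) * int (2 * p choose p)"
    using nonzero_mult_div_cancel_right[of "int (p + 1)"] by (metis of_nat_0_eq_iff add_is_0 one_neq_zero)
  then show ?thesis by (simp only: catalan_def of_nat_div)
qed

section \<open>Upper half of the inverse Z-polynomial\<close>

context sparse_paving_matroid
begin

lemma inverse_KL_low_flat: "\<forall>F \<in> low_flats. inverse_KL (restrict M F) = 1"
proof (intro ballI inverse_KL_boolean)
  fix F assume "F \<in> low_flats"
  then have F: "F \<subseteq> ground M" "F \<in> indep M" using small_indep by (auto simp: low_flats_def)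
  then show "matroid (restrict M F)" by (intro matroid_restrict)
  show "indep (restrict M F) = Pow (ground (restrict M F))"
    using F indep_mono by (auto simp: restrict_def)
qed

text \<open>The restriction is uniform of rank \<open>k - 1\<close> on \<open>k\<close> elements:
  only \<open>H\<close> itself has more than \<open>k - 1\<close> elements. The bound on
  \<open>k\<close> keeps its rank positive.\<close>

lemma sparse_paving_restrict_hyperplane:
  assumes "H \<in> dependent_hyperplanes" "1 < k"
  shows "sparse_paving_matroid (restrict M H) (k - 1)"
proof -
  have H: "H \<subseteq> ground M" "card H = k" "finite H"
    using assms finite_within by (auto simp: dependent_hyperplanes_def)
  show ?thesis
  proof (intro sparse_paving_matroid.intro sparse_paving_matroid_axioms.intro)
    show "matroid (restrict M H)" using H by (intro matroid_restrict)
    show "rk (restrict M H) = k - 1" using rank_dependent_hyperplane assms by simp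
    show "0 < k - 1" using assms by simp
    show "X \<in> indep (restrict M H)" if "X \<subseteq> ground (restrict M H)" "card X < k - 1" for X
      using that H small_indep[of X] by (auto simp: restrict_def)
    show "rank (restrict M H) X = k - 1" if "X \<subseteq> ground (restrict M H)" "k - 1 < card X" for X
    proof -
      have "X = H" using that H by (intro card_seteq) auto
      then show ?thesis using rank_dependent_hyperplane assms by (simp add: rank_restrict)
    qed
  qed
qed

text \<open>The index is \<open>i - 1\<close> because this polynomial enters multiplied by
  \<open>t\<close>. With \<open>k \<le> 2 * i\<close>, the degree bound for rank
  \<open>k - 1\<close> leaves only \<open>2 * i = k\<close>; there the value is the difference of
  the \<open>Y_proper\<close> coefficients at \<open>i\<close> and \<open>i - 1\<close>.\<close>

lemma coeff_inverse_KL_hyperplane: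
  assumes H: "H \<in> dependent_hyperplanes" and "loopless M" "1 < k" "0 < i" "k \<le> 2 * i"
  shows "coeff (inverse_KL (restrict M H)) (i - 1) = (if 2 * i = k then int (catalan i) else 0)"
proof -
  interpret R: sparse_paving_matroid "restrict M H" "k - 1"
    using H \<open>1 < k\<close> by (rule sparse_paving_restrict_hyperplane)
  have H': "H \<subseteq> ground M" "card H = k" "finite H"
    using H finite_within by (auto simp: dependent_hyperplanes_def)
  have none: "R.dependent_hyperplanes = {}"
  proof -
    have "X \<in> indep (restrict M H)" if "X \<subseteq> H" "card X = k - 1" for X
      using that H' small_indep[of X] \<open>1 < k\<close> by (auto simp: restrict_def)
    then show ?thesis unfolding R.dependent_hyperplanes_def ground_restrict by blast
  qed
  have Y: "coeff (Y_proper inverse_KL (restrict M H)) j = int j * int (k choose (j + 1))"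
    if "j \<le> k - 1" for j
  proof (cases "j = 0")
    case True
    then show ?thesis using R.coeff_0_Y_proper[OF R.inverse_KL_low_flat] by simp
  next
    case False
    have "k - (k - 1 - j) - 1 = j" using that False \<open>1 < k\<close> by simp
    moreover have "j choose (j - 1) = j" using binomial_symmetric[of 1 j] False by simp
    moreover have "k choose (k - 1 - j) = k choose (j + 1)"
      using binomial_symmetric[of "j + 1" k] that False by simp
    ultimately show ?thesis
      using R.coeff_Y_proper[OF R.inverse_KL_low_flat, of j] that False H' none by simp
  qed
  have loopless: "loopless (restrict M H)" using H' assms by (intro loopless_restrict)
  show ?thesis
  proof (cases "2 * i = k")
    case True
    then have "coeff (inverse_KL (restrict M H)) (i - 1) =
        coeff (Y_proper inverse_KL (restrict M H)) (k - 1 - (i - 1)) -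
        coeff (Y_proper inverse_KL (restrict M H)) (i - 1)"
      using R.coeff_inverse_KL[OF loopless, of "i - 1"] \<open>0 < i\<close> by simp
    also have "k - 1 - (i - 1) = i" using True \<open>0 < i\<close> by simp
    finally show ?thesis
      using Y[of i] Y[of "i - 1"] True \<open>0 < i\<close> of_nat_catalan[of i] by (simp add: of_nat_diff)
  next
    case False
    then show ?thesis using R.coeff_inverse_KL[OF loopless, of "i - 1"] assms by simp
  qed
qed

lemma inverse_Z_loopless_eq: "inverse_Z_loopless M = Y_proper inverse_KL M + inverse_KL M"
  using Y_sum_eq[of inverse_KL] by (simp add: inverse_Z_loopless_def Y_sum_def Y_term_def)

lemma palindromic_inverse_Z_loopless:
  assumes "loopless M"
  shows "palindromic k (inverse_Z_loopless M)"
  using is_low_part_inverse_KL[OF matroid_axioms assms] rk_eq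
  by (simp add: is_low_part_def inverse_Z_loopless_eq Y_sum_eq[symmetric] palindromic_signed)

text \<open>In the upper half \<open>inverse_KL M\<close> vanishes, so the coefficients are those of
  \<open>Y_proper\<close>. The first term depends only on \<open>k\<close>, \<open>i\<close> and the
  size of the ground set, hence is shared with the uniform matroid.\<close>

lemma coeff_inverse_Z_loopless:
  assumes loopless: "loopless M" and i: "k \<le> 2 * i" "i \<le> k"
  shows "coeff (inverse_Z_loopless M) i =
    int (card (ground M) choose (k - i)) * int (card (ground M) - (k - i) - 1 choose (i - 1))
    - int (card dependent_hyperplanes) * (int (k choose i) - (if 2 * i = k then int (catalan i) else 0))"
proof -
  have pos: "0 < i" using i rank_pos by simp
  have "(\<Sum>H \<in> dependent_hyperplanes. coeff (inverse_KL (restrict M H)) (i - 1)) =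
      (\<Sum>H \<in> dependent_hyperplanes. if 2 * i = k then int (catalan i) else 0)"
  proof (intro sum.cong refl)
    fix H assume H: "H \<in> dependent_hyperplanes"
    \<comment> \<open>In rank 1 a dependent hyperplane would consist of a loop.\<close>
    have "k \<noteq> 1"
    proof
      assume "k = 1"
      moreover have "H \<subseteq> ground M" "card H = k" "H \<notin> indep M"
        using H by (auto simp: dependent_hyperplanes_def)
      ultimately obtain x where "x \<in> ground M" "{x} \<notin> indep M"
        by (metis card_1_singletonE insert_subset)
      then show False using loopless by (auto simp: loopless_def loops_def)
    qed
    then show "coeff (inverse_KL (restrict M H)) (i - 1) = (if 2 * i = k then int (catalan i) else 0)"
      using H loopless i pos rank_pos by (intro coeff_inverse_KL_hyperplane) auto
  qed
  moreover have "coeff (inverse_KL M) i = 0" using coeff_inverse_KL[OF loopless, of i] i by simp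
  ultimately show ?thesis
    unfolding inverse_Z_loopless_eq coeff_add
    using coeff_Y_proper[OF inverse_KL_low_flat pos i(2)] by (simp add: right_diff_distrib)
qed

end

section \<open>Sparse paving matroids and uniform matroids\<close>

lemma dependent_contains_circuit:
  assumes "finite X" "X \<subseteq> ground M" "X \<notin> indep M"
  shows "\<exists>C. circuit M C \<and> C \<subseteq> X"
  using assms
proof (induction X rule: finite_psubset_induct)
  case (psubset X)
  show ?case
  proof (cases "\<forall>D. D \<subset> X \<longrightarrow> D \<in> indep M")
    case True
    then show ?thesis using psubset.prems by (auto simp: circuit_def)
  next
    case False
    then obtain D where "D \<subset> X" "D \<notin> indep M" by blast
    then show ?thesis using psubset.IH[of D] psubset.prems by blast
  qed
qed

lemma (in matroid) paving_small_indep: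
  assumes "paving M" "X \<subseteq> ground M" "card X < rk M"
  shows "X \<in> indep M"
proof (rule ccontr)
  assume "X \<notin> indep M"
  moreover have fin: "finite X" using assms finite_ground finite_subset by blast
  ultimately obtain C where "circuit M C" "C \<subseteq> X" using dependent_contains_circuit assms by blast
  then show False using assms card_mono[OF fin, of C] by (auto simp: paving_def)
qed

lemma (in matroid) basis_iff: "basis M B \<longleftrightarrow> B \<in> indep M \<and> card B = rk M"
proof
  assume B: "basis M B"
  then obtain B' where "B' \<in> indep M" "B \<subseteq> B'" "card B' = rk M"
    using extend_to_rank[of B "ground M"] indep_subset by (auto simp: basis_def rk_def)
  then show "B \<in> indep M \<and> card B = rk M" using B by (auto simp: basis_def)
next
  assume B: "B \<in> indep M \<and> card B = rk M"
  then have "X = B" if "X \<in> indep M" "B \<subseteq> X" for X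
    using that card_le_rank[of X "ground M"] indep_subset finite_indep
    by (metis card_seteq rk_def)
  then show "basis M B" using B by (auto simp: basis_def)
qed

lemma (in matroid) dual_indep_iff:
  "X \<in> indep (dual M) \<longleftrightarrow> X \<subseteq> ground M \<and> rank M (ground M - X) = rk M"
proof -
  have "(\<exists>B. basis M B \<and> X \<inter> B = {}) \<longleftrightarrow> rank M (ground M - X) = rk M"
  proof
    assume "\<exists>B. basis M B \<and> X \<inter> B = {}"
    then obtain B where B: "B \<in> indep M" "card B = rk M" "X \<inter> B = {}" by (auto simp: basis_iff)
    then have "rk M \<le> rank M (ground M - X)"
      using card_le_rank[of B "ground M - X"] indep_subset by auto
    then show "rank M (ground M - X) = rk M" using rank_le_rk[of "ground M - X"] by simp
  next
    assume "rank M (ground M - X) = rk M"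
    then obtain B where "B \<in> indep M" "B \<subseteq> ground M - X" "card B = rk M"
      using rank_attained by metis
    then show "\<exists>B. basis M B \<and> X \<inter> B = {}" by (auto simp: basis_iff)
  qed
  then show ?thesis by (simp add: dual_def)
qed

text \<open>The complement of a non-spanning set is dependent in the dual, so it contains a dual
  circuit; by dual paving that circuit has at least \<open>card (ground M) - rk M\<close> elements,
  more than the complement has.\<close>

lemma (in matroid) paving_dual_large_spans:
  assumes "paving (dual M)" "X \<subseteq> ground M" "rk M < card X"
  shows "rank M X = rk M"
proof (rule ccontr)
  let ?Y = "ground M - X"
  assume "rank M X \<noteq> rk M"
  then have dep: "?Y \<notin> indep (dual M)" using assms by (simp add: dual_indep_iff double_diff)
  have ground_dual: "ground (dual M) = ground M" by (simp add: dual_def)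
  then obtain C where C: "circuit (dual M) C" "C \<subseteq> ?Y"
    using dependent_contains_circuit[of ?Y "dual M"] dep finite_ground by auto
  have le: "rk (dual M) \<le> card C" using assms C by (simp add: paving_def)
  obtain B where B: "B \<in> indep M" "card B = rk M" using rank_attained by (metis rk_def)
  then have BE: "B \<subseteq> ground M" "finite B" using indep_subset finite_indep by auto
  \<comment> \<open>Only a lower bound on the dual rank is used, and the complement of a basis
    provides it.\<close>
  have "card (ground M - B) \<in> card ` {Y \<in> indep (dual M). Y \<subseteq> ground M}"
    using B BE by (auto simp: dual_indep_iff double_diff rank_indep)
  moreover have "finite {Y \<in> indep (dual M). Y \<subseteq> ground M}"
    using finite_ground by (auto intro: finite_subset[of _ "Pow (ground M)"])
  ultimately have "card (ground M - B) \<le> rk (dual M)"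
    unfolding rk_def rank_def using ground_dual by (auto intro!: Max_ge)
  moreover have "card (ground M - B) = card (ground M) - rk M" using B BE by (simp add: card_Diff_subset)
  moreover have "card C \<le> card (ground M) - card X"
    using card_mono[OF _ C(2)] finite_ground assms finite_subset[of X "ground M"]
    by (simp add: card_Diff_subset)
  moreover have "card X \<le> card (ground M)" using assms finite_ground by (intro card_mono)
  ultimately show False using le assms by linarith
qed

lemma (in matroid) sparse_paving_matroidI:
  assumes "sparse_paving M" "0 < rk M"
  shows "sparse_paving_matroid M (rk M)"
  using assms paving_small_indep paving_dual_large_spans
  by unfold_locales (auto simp: sparse_paving_def)

text \<open>A circuit of rank \<open>k - 1\<close> has at most \<open>k\<close> elements, since
  deleting a point leaves an independent set, and at least \<open>k\<close> by
  \<open>small_indep\<close>. Conversely, \<open>small_indep\<close> makes all proper subsets of a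
  dependent \<open>k\<close>-set independent.\<close>

lemma (in sparse_paving_matroid) circuit_hyperplane_iff:
  "circuit_hyperplane M C \<longleftrightarrow> C \<in> dependent_hyperplanes"
proof
  assume "circuit_hyperplane M C"
  then have C: "C \<subseteq> ground M" "C \<notin> indep M" "\<And>D. D \<subset> C \<Longrightarrow> D \<in> indep M" "rank M C + 1 = k"
    using rk_eq by (auto simp: circuit_hyperplane_def circuit_def hyperplane_def)
  have finC: "finite C" using C finite_within by blast
  have "C \<noteq> {}" using C(2) indep_empty by metis
  then obtain x where x: "x \<in> C" by blast
  then have "C - {x} \<in> indep M" using C by blast
  then have "card C - 1 \<le> rank M C" using card_le_rank[of "C - {x}" C] finC x by auto
  moreover have "k \<le> card C" using small_indep[of C] C by force
  ultimately show "C \<in> dependent_hyperplanes" using C by (auto simp: dependent_hyperplanes_def)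
next
  assume C: "C \<in> dependent_hyperplanes"
  then have C': "C \<subseteq> ground M" "card C = k" "C \<notin> indep M" "finite C"
    using finite_within by (auto simp: dependent_hyperplanes_def)
  have "D \<in> indep M" if "D \<subset> C" for D
    using that C' psubset_card_mono[OF C'(4) that] by (intro small_indep) auto
  moreover have "flat M C" using C flats_eq by (auto simp: flats_def)
  ultimately show "circuit_hyperplane M C"
    using C' rank_dependent_hyperplane[OF C] rk_eq rank_pos
    by (auto simp: circuit_hyperplane_def circuit_def hyperplane_def)
qed

section \<open>Uniform matroids and rank 0\<close>

lemma matroid_uniform: "matroid (uniform_matroid k n)"
proof
  show "\<exists>y \<in> Y - X. insert y X \<in> indep (uniform_matroid k n)"
    if "X \<in> indep (uniform_matroid k n)" "Y \<in> indep (uniform_matroid k n)" "card X < card Y" for X Y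
  proof -
    have XY: "X \<subseteq> {1..n}" "Y \<subseteq> {1..n}" "card Y \<le> k" "finite X" "card X < card Y"
      using that finite_subset[of X "{1..n}"] by (auto simp: uniform_matroid_def)
    obtain y where "y \<in> Y - X" using XY card_mono[of X Y] by fastforce
    then have "insert y X \<in> indep (uniform_matroid k n)"
      using XY by (auto simp: uniform_matroid_def)
    then show ?thesis using \<open>y \<in> Y - X\<close> by blast
  qed
  show "Y \<in> indep (uniform_matroid k n)" if "X \<in> indep (uniform_matroid k n)" "Y \<subseteq> X" for X Y
  proof -
    have "finite X" "X \<subseteq> {1..n}" "card X \<le> k"
      using that finite_subset[of X "{1..n}"] by (auto simp: uniform_matroid_def)
    then show ?thesis using that card_mono[of X Y] by (auto simp: uniform_matroid_def)
  qed
qed (auto simp: uniform_matroid_def)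

lemma rank_uniform:
  assumes "X \<subseteq> {1..n}" "k \<le> card X"
  shows "rank (uniform_matroid k n) X = k"
proof -
  interpret matroid "uniform_matroid k n" by (rule matroid_uniform)
  obtain Y where Y: "Y \<subseteq> X" "card Y = k" using assms obtain_subset_with_card_n by metis
  then have "k \<le> rank (uniform_matroid k n) X"
    using card_le_rank[of Y X] assms by (auto simp: uniform_matroid_def)
  moreover obtain B where "B \<in> indep (uniform_matroid k n)" "card B = rank (uniform_matroid k n) X"
    using rank_attained by blast
  ultimately show ?thesis by (auto simp: uniform_matroid_def)
qed

lemma sparse_paving_uniform:
  assumes "0 < k" "k \<le> n"
  shows "sparse_paving_matroid (uniform_matroid k n) k"
proof (intro sparse_paving_matroid.intro sparse_paving_matroid_axioms.intro matroid_uniform)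
  show "rk (uniform_matroid k n) = k"
    unfolding rk_def using assms by (subst rank_uniform) (auto simp: uniform_matroid_def)
  show "rank (uniform_matroid k n) X = k" if "X \<subseteq> ground (uniform_matroid k n)" "k < card X" for X
    using that by (intro rank_uniform) (auto simp: uniform_matroid_def)
qed (use assms in \<open>auto simp: uniform_matroid_def\<close>)

text \<open>Every point is a loop, so both branches of \<open>inverse_Z\<close> reduce to a matroid
  on the empty set.\<close>

lemma inverse_Z_rank_0:
  assumes "matroid M" "rk M = 0"
  shows "inverse_Z M = 1"
proof -
  interpret matroid M by fact
  have "{x} \<notin> indep M" for x
    using card_le_rank[of "{x}" "ground M"] indep_subset[of "{x}"] assms by (auto simp: rk_def)
  then have loops: "loops M = ground M" by (auto simp: loops_def)
  have one: "inverse_Z_loopless N = 1" if N: "matroid N" "ground N = {}" for N :: "'a indep_system"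
  proof -
    interpret N: matroid N by fact
    have rk: "rk N = 0" using N.rank_le_card[of "{}"] N by (simp add: rk_def)
    have fl: "flats N = {ground N}" using flats_subset_ground[of _ N] ground_in_flats[of N] N by auto
    have "inverse_KL N = 1" using N rk by (intro inverse_KL_rank_0) (auto simp: loopless_def loops_def)
    then show ?thesis
      using N.Y_sum_eq[of inverse_KL] rk
      by (simp add: inverse_Z_loopless_def Y_sum_def Y_term_def Y_proper_def fl)
  qed
  show ?thesis
    using one[of M] one[of "restrict M {}"] assms loops matroid_restrict[of "{}"]
    by (auto simp: inverse_Z_def loopless_def)
qed

lemma coeff_one_plus_power: "coeff ([:1, 1:] ^ k :: int poly) i = int (k choose i)"
proof (induction k arbitrary: i)
  case (Suc k)
  then show ?case by (cases i) (simp_all add: add.commute)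
qed (cases i; simp)

theorem theorem1p3:
  fixes M :: "'a indep_system" and k n l :: nat
  assumes "matroid M"
    and "sparse_paving M"
    and "rk M = k"
    and "card (ground M) = n"
    and "card {C. circuit_hyperplane M C} = l"
    and "k = 1 \<Longrightarrow> loopless M"
  shows "inverse_Z M = inverse_Z (uniform_matroid k n)
    - of_nat l * ([:1, 1:] ^ k
        - monom ((((-1) ^ k + 1) div 2) * int (catalan (k div 2))) (k div 2))"
proof (cases "k = 0")
  case True
  \<comment> \<open>In rank 0 both inverse Z-polynomials are 1, and the factor of \<open>l\<close>
    is \<open>1 - 1\<close> because \<open>catalan 0 = 1\<close>.\<close>
  have "rk (uniform_matroid 0 n) = 0"
    unfolding rk_def by (rule rank_uniform) (auto simp: uniform_matroid_def)
  then show ?thesis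
    using True inverse_Z_rank_0[OF assms(1)] inverse_Z_rank_0[OF matroid_uniform] assms(3)
    by (simp add: catalan_def)
next
  case False
  interpret S: sparse_paving_matroid M k
    using matroid.sparse_paving_matroidI[OF assms(1,2)] assms(3) False by simp
  have kn: "k \<le> n" using S.k_le_card assms(4) by simp
  interpret U: sparse_paving_matroid "uniform_matroid k n" k
    using False kn by (intro sparse_paving_uniform) auto
  have l: "card S.dependent_hyperplanes = l"
    using assms(5) by (simp add: S.circuit_hyperplane_iff)
  have none: "U.dependent_hyperplanes = {}"
    unfolding U.dependent_hyperplanes_def by (auto simp: uniform_matroid_def)
  have loopless_M: "loopless M"
  proof (cases "k = 1")
    case False
    then have "{x} \<in> indep M" if "x \<in> ground M" for x
      using that \<open>k \<noteq> 0\<close> by (intro S.small_indep) auto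
    then show ?thesis by (auto simp: loopless_def loops_def)
  qed (use assms(6) in blast)
  have loopless_U: "loopless (uniform_matroid k n)"
    using False by (auto simp: loopless_def loops_def uniform_matroid_def)
  have nU: "card (ground (uniform_matroid k n)) = n" by (simp add: uniform_matroid_def)
  define D where "D = [:1, 1:] ^ k
    - monom ((((-1) ^ k + 1) div 2) * int (catalan (k div 2))) (k div 2)"
  \<comment> \<open>For odd \<open>k\<close> the integer quotient is 0 and no \<open>i\<close>
    satisfies \<open>2 * i = k\<close>, so both forms of the Catalan term vanish.\<close>
  have D: "coeff D i = int (k choose i) - (if 2 * i = k then int (catalan i) else 0)" for i
    by (cases "even k") (auto simp: D_def coeff_one_plus_power)
  have lD: "coeff (of_nat l * D) i = int l * coeff D i" for i by (simp add: of_nat_poly)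
  have "inverse_Z_loopless M = inverse_Z_loopless (uniform_matroid k n) - of_nat l * D"
    (is "?Y = ?Z")
  proof (rule poly_eqI)
    \<comment> \<open>The uniform matroid has the same \<open>k\<close> and \<open>n\<close> and no
      dependent hyperplanes, so the difference in the upper half is exactly \<open>l\<close> times
      \<open>D\<close>.\<close>
    have high: "coeff ?Y i = coeff ?Z i" if "k \<le> 2 * i" "i \<le> k" for i
      using S.coeff_inverse_Z_loopless[OF loopless_M that]
        U.coeff_inverse_Z_loopless[OF loopless_U that] l none nU assms(4) by (simp add: lD D)
    \<comment> \<open>The lower half follows by symmetry about \<open>k / 2\<close>, which both
      inverse Z-polynomials and \<open>D\<close> possess.\<close>
    have symY: "coeff ?Y i = (if i \<le> k then coeff ?Y (k - i) else 0)" for i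
      using S.palindromic_inverse_Z_loopless[OF loopless_M] by (metis palindromic_def coeff_reversal)
    have symU: "coeff (inverse_Z_loopless (uniform_matroid k n)) i =
        (if i \<le> k then coeff (inverse_Z_loopless (uniform_matroid k n)) (k - i) else 0)" for i
      using U.palindromic_inverse_Z_loopless[OF loopless_U] by (metis palindromic_def coeff_reversal)
    have symD: "coeff D i = (if i \<le> k then coeff D (k - i) else 0)" for i
    proof -
      have "2 * (k - i) = k \<longleftrightarrow> 2 * i = k" if "i \<le> k" using that by auto
      moreover have "k - i = i" if "2 * i = k" using that by auto
      ultimately show ?thesis unfolding D using binomial_symmetric[of i k] by (auto simp: binomial_eq_0)
    qed
    have symZ: "coeff ?Z i = (if i \<le> k then coeff ?Z (k - i) else 0)" for i
      using symU[of i] symD[of i] by (simp add: lD)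
    show "coeff ?Y i = coeff ?Z i" for i
      using symY[of i] symZ[of i] high[of i] high[of "k - i"] by (cases "k \<le> 2 * i") auto
  qed
  then show ?thesis using loopless_M loopless_U by (simp add: inverse_Z_def D_def)
qed

end
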